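(* Let $(M,g,\xi,\lambda)$ be an $n$-dimensional connected Yamabe soliton with $n>2$ and scalar curvature $R$. Suppose the soliton field $\xi$ satisfies $\Delta\xi=-\mu\,\xi$ and $Q(\xi)=\nu\,\xi$ for constants $\mu\ge 0$ and $\nu\in\mathbb{R}$, and that $$\lambda\le R\le n(n-1)\mu\quad\text{on } M.$$ Then $g$ is a Yamabe metric, i.e. $R$ is constant on $M$.
   Context: A Yamabe soliton $(M,g,\xi,\lambda)$ is a connected smooth Riemannian manifold $(M,g)$ together with a smooth vector field $\xi$ (the soliton field) and a constant $\lambda\in\mathbb{R}$ such that $\frac12\mathcal{L}_\xi g=(R-\lambda)g$, where $\mathcal{L}_\xi$ is the Lie derivative and $R$ is the scalar curvature of $g$. No compactness or completeness is assumed. The metric $g$ is called a Yamabe metric if $R$ is constant. $\mathrm{Ric}$ is the Ricci tensor, $\nabla$ the Levi-Civita connection, and the Ricci operator $Q$ is defined by $g(QX,Y)=\mathrm{Ric}(X,Y)$. The Laplace operator on smooth vector fields is $\Delta X=\sum_{i=1}^n\left(\nabla_{e_i}\nabla_{e_i}X-\nabla_{\nabla_{e_i}e_i}X\right)$ for a local orthonormal frame $\{e_1,\dots,e_n\}$. *)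

theory Defs
  imports "HOL-Analysis.Analysis"
begin

section \<open>Smooth maps\<close>

text \<open>The set \<open>S\<close> is always open below.\<close>

primrec Ck_on :: "nat \<Rightarrow> 'a::real_normed_vector set \<Rightarrow> ('a \<Rightarrow> 'b::real_normed_vector) \<Rightarrow> bool" where
  "Ck_on 0 S f \<longleftrightarrow> continuous_on S f"
| "Ck_on (Suc k) S f \<longleftrightarrow>
     (\<forall>x\<in>S. f differentiable (at x)) \<and>
     (\<forall>v. Ck_on k S (\<lambda>x. frechet_derivative f (at x) v))"

definition smooth_on :: "'a::real_normed_vector set \<Rightarrow> ('a \<Rightarrow> 'b::real_normed_vector) \<Rightarrow> bool" where
  "smooth_on S f \<longleftrightarrow> (\<forall>k. Ck_on k S f)"


section \<open>Smooth manifolds\<close>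

text \<open>A chart is its domain together with a coordinate map; the values of the coordinate map outside
  the domain are irrelevant. The dimension of the manifold is \<open>CARD('n)\<close>.\<close>

type_synonym ('a, 'n) chart = "'a set \<times> ('a \<Rightarrow> real ^ 'n)"

abbreviation chart_dom :: "('a, 'n) chart \<Rightarrow> 'a set" where
  "chart_dom c \<equiv> fst c"

abbreviation chart_map :: "('a, 'n) chart \<Rightarrow> 'a \<Rightarrow> real ^ 'n" where
  "chart_map c \<equiv> snd c"

definition chart_img :: "('a, 'n) chart \<Rightarrow> (real ^ 'n) set" where
  "chart_img c = chart_map c ` chart_dom c"

definition is_chart :: "'a topology \<Rightarrow> ('a, 'n::finite) chart \<Rightarrow> bool" where
  "is_chart M c \<longleftrightarrow>
     openin M (chart_dom c) \<and> open (chart_img c) \<and>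
     homeomorphic_map (subtopology M (chart_dom c)) (top_of_set (chart_img c)) (chart_map c)"

definition overlap :: "('a, 'n) chart \<Rightarrow> ('a, 'n) chart \<Rightarrow> (real ^ 'n) set" where
  "overlap c d = chart_map c ` (chart_dom c \<inter> chart_dom d)"

definition transition :: "('a, 'n) chart \<Rightarrow> ('a, 'n) chart \<Rightarrow> real ^ 'n \<Rightarrow> real ^ 'n" where
  "transition c d = chart_map d \<circ> inv_into (chart_dom c) (chart_map c)"

text \<open>The smooth structure is given by an arbitrary smooth atlas, not necessarily a maximal one:
  tensor fields are determined by their components in the charts of any atlas.\<close>

definition smooth_manifold :: "'a topology \<Rightarrow> ('a, 'n::finite) chart set \<Rightarrow> bool" where
  "smooth_manifold M A \<longleftrightarrow>
     Hausdorff_space M \<and> second_countable M \<and>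
     (\<forall>c\<in>A. is_chart M c) \<and> (\<Union>c\<in>A. chart_dom c) = topspace M \<and>
     (\<forall>c\<in>A. \<forall>d\<in>A. smooth_on (overlap c d) (transition c d))"


section \<open>Vector fields and Riemannian metrics\<close>

text \<open>Tensor fields on the manifold are families of component functions, one for each chart, that
  satisfy the tensorial transformation law under change of charts.\<close>

type_synonym 'n vfield = "real ^ 'n \<Rightarrow> real ^ 'n"
type_synonym 'n metric = "real ^ 'n \<Rightarrow> real ^ 'n \<Rightarrow> real ^ 'n \<Rightarrow> real"

definition smooth_vector_field ::
    "('a, 'n::finite) chart set \<Rightarrow> (('a, 'n) chart \<Rightarrow> 'n vfield) \<Rightarrow> bool" where
  "smooth_vector_field A X \<longleftrightarrow>
     (\<forall>c\<in>A. smooth_on (chart_img c) (X c)) \<and>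
     (\<forall>c\<in>A. \<forall>d\<in>A. \<forall>x\<in>overlap c d.
        X d (transition c d x) = frechet_derivative (transition c d) (at x) (X c x))"

definition riemannian_metric ::
    "('a, 'n::finite) chart set \<Rightarrow> (('a, 'n) chart \<Rightarrow> 'n metric) \<Rightarrow> bool" where
  "riemannian_metric A g \<longleftrightarrow>
     (\<forall>c\<in>A.
        (\<forall>u v. smooth_on (chart_img c) (\<lambda>x. g c x u v)) \<and>
        (\<forall>x\<in>chart_img c. bilinear (g c x) \<and> (\<forall>u v. g c x u v = g c x v u) \<and>
                          (\<forall>u. u \<noteq> 0 \<longrightarrow> g c x u u > 0))) \<and>
     (\<forall>c\<in>A. \<forall>d\<in>A. \<forall>x\<in>overlap c d. \<forall>u v.
        g d (transition c d x) (frechet_derivative (transition c d) (at x) u)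
                               (frechet_derivative (transition c d) (at x) v) = g c x u v)"


section \<open>Riemannian geometry in a chart\<close>

text \<open>Here \<open>G\<close> is the metric and \<open>X\<close>, \<open>Y\<close>, \<open>Z\<close> are vector fields, all in the coordinates of one chart.
  All notions at \<open>x\<close> depend only on the germs at \<open>x\<close> of the data.\<close>

definition lie_bracket :: "'n::finite vfield \<Rightarrow> 'n vfield \<Rightarrow> 'n vfield" where
  "lie_bracket X Y x = frechet_derivative Y (at x) (X x) - frechet_derivative X (at x) (Y x)"

text \<open>\<open>(\<L>\<^sub>Z g)(X, Y) = Z (g(X, Y)) - g([Z, X], Y) - g(X, [Z, Y])\<close>\<close>

definition lie_derivative_metric ::
    "'n::finite metric \<Rightarrow> 'n vfield \<Rightarrow> 'n vfield \<Rightarrow> 'n vfield \<Rightarrow> real ^ 'n \<Rightarrow> real" where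
  "lie_derivative_metric G Z X Y x =
     frechet_derivative (\<lambda>y. G y (X y) (Y y)) (at x) (Z x)
     - G x (lie_bracket Z X x) (Y x) - G x (X x) (lie_bracket Z Y x)"

text \<open>Connection coefficients \<open>\<Gamma>\<close> of the Levi-Civita connection, the unique connection
  \<open>\<nabla>\<^sub>X Y = D\<^sub>X Y + \<Gamma>(X, Y)\<close> that is torsion-free (\<open>\<Gamma>\<close> is symmetric) and metric. Both conditions are
  expressed on constant coordinate vector fields.\<close>

definition levi_civita :: "'n::finite metric \<Rightarrow> real ^ 'n \<Rightarrow> real ^ 'n \<Rightarrow> real ^ 'n \<Rightarrow> real ^ 'n" where
  "levi_civita G x = (THE \<Gamma>. bilinear \<Gamma> \<and> (\<forall>u v. \<Gamma> u v = \<Gamma> v u) \<and>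
     (\<forall>u v w. frechet_derivative (\<lambda>y. G y u v) (at x) w = G x (\<Gamma> w u) v + G x u (\<Gamma> w v)))"

definition cov :: "'n::finite metric \<Rightarrow> 'n vfield \<Rightarrow> 'n vfield \<Rightarrow> 'n vfield" where
  "cov G X Y x = frechet_derivative Y (at x) (X x) + levi_civita G x (X x) (Y x)"

definition curvature :: "'n::finite metric \<Rightarrow> 'n vfield \<Rightarrow> 'n vfield \<Rightarrow> 'n vfield \<Rightarrow> 'n vfield" where
  "curvature G X Y Z x =
     cov G X (cov G Y Z) x - cov G Y (cov G X Z) x - cov G (lie_bracket X Y) Z x"

text \<open>\<open>Ric(u, v)\<close> is the trace of \<open>w \<mapsto> R(w, u) v\<close>; the curvature being a tensor, the vectors may be
  extended to constant fields.\<close>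

definition ricci :: "'n::finite metric \<Rightarrow> real ^ 'n \<Rightarrow> real ^ 'n \<Rightarrow> real ^ 'n \<Rightarrow> real" where
  "ricci G x u v = trace (matrix (\<lambda>w. curvature G (\<lambda>_. w) (\<lambda>_. u) (\<lambda>_. v) x))"

definition ricci_operator :: "'n::finite metric \<Rightarrow> real ^ 'n \<Rightarrow> real ^ 'n \<Rightarrow> real ^ 'n" where
  "ricci_operator G x u = (THE w. \<forall>v. G x w v = ricci G x u v)"

definition scalar_curvature :: "'n::finite metric \<Rightarrow> real ^ 'n \<Rightarrow> real" where
  "scalar_curvature G x = trace (matrix (ricci_operator G x))"

definition orthonormal_frame ::
    "'n::finite metric \<Rightarrow> (real ^ 'n) set \<Rightarrow> ('n \<Rightarrow> 'n vfield) \<Rightarrow> bool" where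
  "orthonormal_frame G V e \<longleftrightarrow>
     (\<forall>i. smooth_on V (e i)) \<and>
     (\<forall>x\<in>V. \<forall>i j. G x (e i x) (e j x) = (if i = j then 1 else 0))"

text \<open>The Laplacian of vector fields; the value does not depend on the local orthonormal frame that
  is chosen around \<open>x\<close>.\<close>

definition vector_laplacian :: "'n::finite metric \<Rightarrow> 'n vfield \<Rightarrow> 'n vfield" where
  "vector_laplacian G X x =
     (let e = (SOME e. \<exists>V. open V \<and> x \<in> V \<and> orthonormal_frame G V e)
      in \<Sum>i\<in>UNIV. cov G (e i) (cov G (e i) X) x - cov G (cov G (e i) (e i)) X x)"


section \<open>Yamabe solitons\<close>

definition yamabe_soliton ::
    "'a topology \<Rightarrow> ('a, 'n::finite) chart set \<Rightarrow> (('a, 'n) chart \<Rightarrow> 'n metric) \<Rightarrow>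
     (('a, 'n) chart \<Rightarrow> 'n vfield) \<Rightarrow> real \<Rightarrow> bool" where
  "yamabe_soliton M A g \<xi> lam \<longleftrightarrow>
     connected_space M \<and> smooth_manifold M A \<and> riemannian_metric A g \<and> smooth_vector_field A \<xi> \<and>
     (\<forall>c\<in>A. \<forall>X Y. smooth_on (chart_img c) X \<longrightarrow> smooth_on (chart_img c) Y \<longrightarrow>
        (\<forall>x\<in>chart_img c. 1 / 2 * lie_derivative_metric (g c) (\<xi> c) X Y x
           = (scalar_curvature (g c) x - lam) * g c x (X x) (Y x)))"

text \<open>The scalar curvature is a function on the manifold: the constant is the same for all charts.\<close>

definition yamabe_metric ::
    "('a, 'n::finite) chart set \<Rightarrow> (('a, 'n) chart \<Rightarrow> 'n metric) \<Rightarrow> bool" where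
  "yamabe_metric A g \<longleftrightarrow> (\<exists>k. \<forall>c\<in>A. \<forall>x\<in>chart_img c. scalar_curvature (g c) x = k)"

end

theory Submission
  imports Defs
begin

text \<open>
  Put \<open>f = R - lam\<close>. The soliton equation says that \<open>\<xi>\<close> is a conformal field, that is, the symmetric
  part of \<open>\<nabla>\<xi>\<close> is \<open>f\<close> times the identity. For conformal fields, commuting covariant derivatives gives
  Yano's formula \<open>\<Delta>\<xi> + Q\<xi> + (n - 2) \<nabla>f = 0\<close> (\<open>laplacian_conformal\<close>), so the hypotheses on \<open>\<Delta>\<xi>\<close>
  and \<open>Q\<xi>\<close> yield \<open>(n - 2) \<nabla>R = (\<mu> - \<nu>) \<xi>\<close>. If \<open>\<mu> = \<nu>\<close>, then \<open>R\<close> is locally constant.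

  Otherwise \<open>\<xi>\<close> is a constant multiple of a gradient, hence \<open>\<nabla>\<xi>\<close> is symmetric and \<open>\<nabla>\<^sub>u \<xi> = f u\<close>
  (\<open>gradient_imp_concircular\<close>). Then \<open>\<Delta>\<xi> = \<nabla>f\<close>, that is, \<open>\<nabla>R = - \<mu> \<xi>\<close>, and comparison with the
  first equation gives \<open>\<nu> = (n - 1) \<mu>\<close> wherever \<open>\<xi>\<close> does not vanish. Taking the divergence of
  \<open>Q\<xi> = \<nu>\<xi>\<close> and using the contracted Bianchi identity, one finds
  \<open>\<xi>(R) = 2 f (n \<nu> - R) = 2 (R - lam) (n (n - 1) \<mu> - R)\<close> (\<open>D_scalar_curvature_concircular\<close>). The bounds
  on \<open>R\<close> make the right-hand side nonnegative, whereas the left-hand side is \<open>- \<mu> |\<xi>|\<^sup>2\<close>. Hence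
  \<open>\<mu> \<xi> = 0\<close>, so \<open>\<nabla>R = 0\<close> at every point, and \<open>R\<close> is constant because \<open>M\<close> is connected.

  All of this is local and takes place in one chart, in the locale \<open>riemannian_chart\<close>. The curvature
  identities are obtained from the operators \<open>nab u\<close>, the covariant derivatives along constant fields:
  as these fields commute, the curvature is a commutator and the second Bianchi identity is a Jacobi
  identity. Passing from charts to the manifold requires that \<open>R\<close> does not depend on the chart; for
  a soliton this follows from the invariance of the Lie derivative
  (\<open>soliton_scalar_curvature_chart_independent\<close>).
\<close>

section \<open>Calculus of smooth maps\<close>

abbreviation D :: "('a::real_normed_vector \<Rightarrow> 'b::real_normed_vector) \<Rightarrow> 'a \<Rightarrow> 'a \<Rightarrow> 'b" where
  "D f x \<equiv> frechet_derivative f (at x)"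

lemma D_eqI: "(f has_derivative f') (at x) \<Longrightarrow> D f x = f'"
  by (metis frechet_derivative_at)

lemma D_cong:
  assumes "open S" "x \<in> S" "\<And>y. y \<in> S \<Longrightarrow> f y = g y"
  shows "D f x = D g x"
proof -
  have "(f has_derivative f') (at x) \<longleftrightarrow> (g has_derivative f') (at x)" for f'
    using has_derivative_transform_within_open[OF _ assms(1,2), of f f' UNIV g]
      has_derivative_transform_within_open[OF _ assms(1,2), of g f' UNIV f] assms(3) by auto
  then show ?thesis by (simp add: frechet_derivative_def)
qed

lemma D_add:
  assumes "f differentiable at x" "g differentiable at x"
  shows "D (\<lambda>y. f y + g y) x v = D f x v + D g x v"
  using D_eqI[OF has_derivative_add[OF assms[unfolded frechet_derivative_works]]] by simp

lemma D_diff: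
  assumes "f differentiable at x" "g differentiable at x"
  shows "D (\<lambda>y. f y - g y) x v = D f x v - D g x v"
  using D_eqI[OF has_derivative_diff[OF assms[unfolded frechet_derivative_works]]] by simp

lemma D_sum:
  assumes "\<And>i. i \<in> I \<Longrightarrow> f i differentiable at x"
  shows "D (\<lambda>y. \<Sum>i\<in>I. f i y) x v = (\<Sum>i\<in>I. D (f i) x v)"
proof -
  have "((\<lambda>y. \<Sum>i\<in>I. f i y) has_derivative (\<lambda>v. \<Sum>i\<in>I. D (f i) x v)) (at x)"
    using assms by (intro has_derivative_sum) (simp add: frechet_derivative_works)
  then show ?thesis by (simp add: D_eqI)
qed

lemma (in bounded_linear) D_compose:
  assumes "g differentiable at x"
  shows "D (\<lambda>y. f (g y)) x v = f (D g x v)"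
  using D_eqI[OF has_derivative[OF assms[unfolded frechet_derivative_works]]] by simp

lemma (in bounded_bilinear) D_prod:
  assumes "f differentiable at x" "g differentiable at x"
  shows "D (\<lambda>y. prod (f y) (g y)) x v = prod (f x) (D g x v) + prod (D f x v) (g x)"
  using D_eqI[OF FDERIV[OF assms[unfolded frechet_derivative_works]]] by simp

lemma differentiable_cong_open:
  assumes "open S" "x \<in> S" "\<And>y. y \<in> S \<Longrightarrow> f y = g y" "f differentiable at x"
  shows "g differentiable at x"
  using has_derivative_transform_within_open[OF _ assms(1,2), of f _ UNIV g] assms(3,4)
  unfolding differentiable_def by auto

lemma Ck_on_cong:
  assumes "open S" "\<And>y. y \<in> S \<Longrightarrow> f y = g y" "Ck_on k S f"
  shows "Ck_on k S g"
  using assms(2,3)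
proof (induction k arbitrary: f g)
  case 0
  then show ?case by (simp cong: continuous_on_cong)
next
  case (Suc k)
  have "g differentiable at x" if "x \<in> S" for x
    using differentiable_cong_open[OF assms(1) that Suc.prems(1)] Suc.prems(2) that by simp
  moreover have "Ck_on k S (\<lambda>x. D g x v)" for v
    using Suc.IH[of "\<lambda>x. D f x v"] D_cong[OF assms(1) _ Suc.prems(1)] Suc.prems(2) by simp
  ultimately show ?case by simp
qed

lemma Ck_on_SucD: "Ck_on (Suc k) S f \<Longrightarrow> Ck_on k S f"
proof (induction k arbitrary: f)
  case 0
  then show ?case
    by (auto intro!: continuous_at_imp_continuous_on differentiable_imp_continuous_within)
next
  case (Suc k)
  have "Ck_on (Suc k) S (\<lambda>x. D f x v)" for v
    using Suc.prems by (simp only: Ck_on.simps(2)[of "Suc k"])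
  then show ?case
    using Suc by simp
qed

lemma smooth_on_cong:
  assumes "open S" "\<And>y. y \<in> S \<Longrightarrow> f y = g y" "smooth_on S f"
  shows "smooth_on S g"
  unfolding smooth_on_def
proof
  fix k
  have "Ck_on k S f" using assms(3) by (simp add: smooth_on_def)
  with assms(1,2) show "Ck_on k S g" by (rule Ck_on_cong)
qed

lemma smooth_on_D: "smooth_on S f \<Longrightarrow> smooth_on S (\<lambda>x. D f x v)"
  unfolding smooth_on_def using Ck_on.simps(2)[of _ S f] by blast

lemma smooth_on_differentiable: "smooth_on S f \<Longrightarrow> x \<in> S \<Longrightarrow> f differentiable at x"
  unfolding smooth_on_def using Ck_on.simps(2)[of _ S f] by blast

lemma smooth_on_continuous: "smooth_on S f \<Longrightarrow> continuous_on S f"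
  unfolding smooth_on_def by (drule spec[of _ 0]) simp

lemma smooth_on_has_derivative:
  "smooth_on S f \<Longrightarrow> x \<in> S \<Longrightarrow> (f has_derivative D f x) (at x)"
  using smooth_on_differentiable frechet_derivative_works by blast

lemma smooth_on_linear_D: "smooth_on S f \<Longrightarrow> x \<in> S \<Longrightarrow> linear (D f x)"
  using smooth_on_differentiable linear_frechet_derivative by blast

lemma smooth_on_const: "smooth_on S (\<lambda>_. c)"
proof -
  have "Ck_on k S (\<lambda>_. c)" for k and c :: 'b
    by (induction k arbitrary: c) auto
  then show ?thesis by (simp add: smooth_on_def)
qed

lemma Ck_on_add:
  assumes "open S"
  shows "Ck_on k S f \<Longrightarrow> Ck_on k S g \<Longrightarrow> Ck_on k S (\<lambda>x. f x + g x)"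
proof (induction k arbitrary: f g)
  case (Suc k)
  have "Ck_on k S (\<lambda>x. D f x v + D g x v)" for v
    using Suc by auto
  then have "Ck_on k S (\<lambda>x. D (\<lambda>y. f y + g y) x v)" for v
    by (rule Ck_on_cong[OF assms(1), rotated]) (use Suc.prems in \<open>simp add: D_add\<close>)
  then show ?case using Suc.prems by simp
qed (auto intro: continuous_intros)

lemma smooth_on_add:
  "open S \<Longrightarrow> smooth_on S f \<Longrightarrow> smooth_on S g \<Longrightarrow> smooth_on S (\<lambda>x. f x + g x)"
  by (simp add: smooth_on_def Ck_on_add)

lemma (in bounded_linear) smooth_on_compose:
  assumes "open S" "smooth_on S g"
  shows "smooth_on S (\<lambda>x. f (g x))"
proof -
  have "Ck_on k S g \<Longrightarrow> Ck_on k S (\<lambda>x. f (g x))" for k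
  proof (induction k arbitrary: g)
    case (Suc k)
    have "Ck_on k S (\<lambda>x. f (D g x v))" for v
      using Suc by auto
    then have "Ck_on k S (\<lambda>x. D (\<lambda>y. f (g y)) x v)" for v
      by (rule Ck_on_cong[OF assms(1), rotated]) (use Suc.prems in \<open>simp add: D_compose\<close>)
    moreover have "(\<lambda>x. f (g x)) differentiable at x" if "x \<in> S" for x
      using has_derivative[of g "D g x" "at x"] Suc.prems that
      by (auto simp: differentiable_def frechet_derivative_works[symmetric])
    ultimately show ?case by simp
  qed (simp add: continuous_on)
  then show ?thesis using assms by (simp add: smooth_on_def)
qed

lemma (in bounded_bilinear) Ck_on_prod:
  assumes "open S"
  shows "Ck_on k S f \<Longrightarrow> Ck_on k S g \<Longrightarrow> Ck_on k S (\<lambda>x. prod (f x) (g x))"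
proof (induction k arbitrary: f g)
  case (Suc k)
  have diff: "f differentiable at x" "g differentiable at x" if "x \<in> S" for x
    using Suc.prems that by auto
  have "Ck_on k S (\<lambda>x. prod (f x) (D g x v) + prod (D f x v) (g x))" for v
    using Suc.prems Suc.IH[OF Ck_on_SucD[OF Suc.prems(1)]] Suc.IH[OF _ Ck_on_SucD[OF Suc.prems(2)]]
    by (intro Ck_on_add[OF assms]) auto
  then have "Ck_on k S (\<lambda>x. D (\<lambda>y. prod (f y) (g y)) x v)" for v
    by (rule Ck_on_cong[OF assms(1), rotated]) (simp add: diff D_prod)
  moreover have "(\<lambda>x. prod (f x) (g x)) differentiable at x" if "x \<in> S" for x
    using FDERIV[OF diff[OF that, unfolded frechet_derivative_works]] by (auto simp: differentiable_def)
  ultimately show ?case by simp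
qed (simp add: continuous_on)

lemma (in bounded_bilinear) smooth_on_prod:
  "open S \<Longrightarrow> smooth_on S f \<Longrightarrow> smooth_on S g \<Longrightarrow> smooth_on S (\<lambda>x. prod (f x) (g x))"
  by (simp add: smooth_on_def Ck_on_prod)

lemmas smooth_on_scaleR = bounded_bilinear.smooth_on_prod[OF bounded_bilinear_scaleR]
lemmas smooth_on_mult = bounded_bilinear.smooth_on_prod[OF bounded_bilinear_mult]
lemmas smooth_on_uminus = bounded_linear.smooth_on_compose[OF bounded_linear_minus[OF bounded_linear_ident]]
lemmas smooth_on_vec_nth = bounded_linear.smooth_on_compose[OF bounded_linear_vec_nth]

lemma smooth_on_diff:
  assumes "open S" "smooth_on S f" "smooth_on S g"
  shows "smooth_on S (\<lambda>x. f x - g x)"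
  using smooth_on_add[OF assms(1,2) smooth_on_uminus[OF assms(1,3)]] by simp

lemma smooth_on_sum:
  assumes "open S" "\<And>i. i \<in> I \<Longrightarrow> smooth_on S (f i)"
  shows "smooth_on S (\<lambda>x. \<Sum>i\<in>I. f i x)"
  using assms(2) by (induction I rule: infinite_finite_induct)
    (simp_all add: smooth_on_const smooth_on_add[OF assms(1)])

text \<open>Differentiating a power gives a multiple of a power with another exponent, so the induction on
  the order of differentiability is over all exponents simultaneously.\<close>

lemma smooth_on_powr:
  fixes h :: "'a::real_normed_vector \<Rightarrow> real"
  assumes "open S" "smooth_on S h" "\<And>x. x \<in> S \<Longrightarrow> h x > 0"
  shows "smooth_on S (\<lambda>x. h x powr a)"
proof -
  have "Ck_on k S (\<lambda>x. h x powr a)" for k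
  proof (induction k arbitrary: a)
    case 0
    then show ?case using smooth_on_continuous[OF assms(2)] assms(3)
      by (auto intro!: continuous_on_powr continuous_on_const) force
  next
    case (Suc k)
    have der: "((\<lambda>y. h y powr a) has_derivative (\<lambda>v. D h x v * (a * h x powr (a - 1)))) (at x)"
      if "x \<in> S" for x
      using DERIV_compose_FDERIV[OF has_real_derivative_powr[OF assms(3)[OF that]]
          smooth_on_has_derivative[OF assms(2) that]] .
    have "Ck_on k S (\<lambda>x. D h x v)" for v
      using smooth_on_D[OF assms(2)] by (simp add: smooth_on_def)
    moreover have "Ck_on k S (\<lambda>x. a * h x powr (a - 1))"
      using bounded_bilinear.Ck_on_prod[OF bounded_bilinear_mult assms(1) _ Suc.IH]
        smooth_on_const[of S a] by (auto simp: smooth_on_def)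
    ultimately have prod: "Ck_on k S (\<lambda>x. D h x v * (a * h x powr (a - 1)))" for v
      using bounded_bilinear.Ck_on_prod[OF bounded_bilinear_mult assms(1)] by blast
    have "Ck_on k S (\<lambda>x. D (\<lambda>y. h y powr a) x v)" for v
      by (rule Ck_on_cong[OF assms(1) _ prod[of v]]) (simp add: D_eqI[OF der])
    then show ?case using der by (auto simp: differentiable_def)
  qed
  then show ?thesis by (simp add: smooth_on_def)
qed

subsection \<open>Symmetry of second derivatives\<close>

text \<open>The mean value theorem, applied in the direction \<open>u\<close> and then in the direction \<open>v\<close>, turns the
  second difference over a parallelogram into a mixed second derivative. The second difference is
  symmetric in \<open>u\<close> and \<open>v\<close>, which is why mixed derivatives commute.\<close>

lemma mixed_second_difference:
  fixes f :: "'a::real_normed_vector \<Rightarrow> real"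
  assumes h: "h > 0" "h * (norm u + norm v) < d"
    and f: "\<And>y. y \<in> ball x d \<Longrightarrow> f differentiable at y"
    and g: "\<And>y. y \<in> ball x d \<Longrightarrow> (\<lambda>z. D f z u) differentiable at y"
  obtains z where "z \<in> ball x d"
    "f (x + h *\<^sub>R u + h *\<^sub>R v) - f (x + h *\<^sub>R u) - f (x + h *\<^sub>R v) + f x = h^2 * D (\<lambda>y. D f y u) z v"
proof -
  have ball: "x + s *\<^sub>R u + t *\<^sub>R v \<in> ball x d" if "0 \<le> s" "s \<le> h" "0 \<le> t" "t \<le> h" for s t
  proof -
    have "norm (s *\<^sub>R u + t *\<^sub>R v) \<le> s * norm u + t * norm v"
      using norm_triangle_ineq[of "s *\<^sub>R u" "t *\<^sub>R v"] that by simp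
    also have "\<dots> \<le> h * norm u + h * norm v"
      using that by (intro add_mono mult_right_mono) auto
    finally have "norm (s *\<^sub>R u + t *\<^sub>R v) < d"
      using h(2) by (simp add: distrib_left)
    moreover have "dist x (x + s *\<^sub>R u + t *\<^sub>R v) = norm (s *\<^sub>R u + t *\<^sub>R v)"
      using dist_norm[of "x + (s *\<^sub>R u + t *\<^sub>R v)" x]
      by (simp only: add.assoc add_diff_cancel_left' dist_commute)
    ultimately show ?thesis by simp
  qed
  have line: "((\<lambda>s. k (p + s *\<^sub>R w)) has_real_derivative D k (p + s *\<^sub>R w) w) (at s)"
    if "k differentiable at (p + s *\<^sub>R w)" for k :: "'a \<Rightarrow> real" and p w s
  proof -
    have "((\<lambda>s. k (p + s *\<^sub>R w)) has_derivative (\<lambda>r. D k (p + s *\<^sub>R w) (r *\<^sub>R w))) (at s)"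
      by (rule has_derivative_compose[where f = "\<lambda>s. p + s *\<^sub>R w" and g = k])
        (auto intro!: derivative_eq_intros simp: that[unfolded frechet_derivative_works])
    moreover have "(\<lambda>r. D k (p + s *\<^sub>R w) (r *\<^sub>R w)) = (*) (D k (p + s *\<^sub>R w) w)"
      by (rule ext) (simp add: linear_cmul[OF linear_frechet_derivative[OF that]])
    ultimately show ?thesis by (simp only: has_field_derivative_def)
  qed
  define q where "q s = f (x + h *\<^sub>R v + s *\<^sub>R u) - f (x + s *\<^sub>R u)" for s
  have b1: "x + h *\<^sub>R v + s *\<^sub>R u \<in> ball x d" "x + s *\<^sub>R u \<in> ball x d" if "0 \<le> s" "s \<le> h" for s
    using ball[of s h] ball[of s 0] that h(1) by (simp_all add: algebra_simps)
  have "(q has_real_derivative D f (x + h *\<^sub>R v + s *\<^sub>R u) u - D f (x + s *\<^sub>R u) u) (at s)"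
    if "0 \<le> s" "s \<le> h" for s
    unfolding q_def by (intro DERIV_diff line f b1 that)
  from MVT2[OF h(1) this] obtain s where s: "0 < s" "s < h"
    "q h - q 0 = h * (D f (x + h *\<^sub>R v + s *\<^sub>R u) u - D f (x + s *\<^sub>R u) u)" by auto
  have "((\<lambda>t. D f (x + s *\<^sub>R u + t *\<^sub>R v) u) has_real_derivative
      D (\<lambda>y. D f y u) (x + s *\<^sub>R u + t *\<^sub>R v) v) (at t)" if "0 \<le> t" "t \<le> h" for t
    using line[of "\<lambda>y. D f y u", OF g[OF ball]] s that by simp
  from MVT2[OF h(1) this] obtain t where t: "0 < t" "t < h"
    "D f (x + s *\<^sub>R u + h *\<^sub>R v) u - D f (x + s *\<^sub>R u) u = h * D (\<lambda>y. D f y u) (x + s *\<^sub>R u + t *\<^sub>R v) v"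
    by auto
  show ?thesis
  proof
    show "x + s *\<^sub>R u + t *\<^sub>R v \<in> ball x d" using ball s t by simp
    have "q h - q 0 = h * (h * D (\<lambda>y. D f y u) (x + s *\<^sub>R u + t *\<^sub>R v) v)"
      using s(3) t(3) by (simp add: add_ac)
    then show "f (x + h *\<^sub>R u + h *\<^sub>R v) - f (x + h *\<^sub>R u) - f (x + h *\<^sub>R v) + f x
        = h^2 * D (\<lambda>y. D f y u) (x + s *\<^sub>R u + t *\<^sub>R v) v"
      by (simp add: q_def power2_eq_square add_ac)
  qed
qed

lemma second_derivative_symmetric_real:
  fixes f :: "'a::real_normed_vector \<Rightarrow> real"
  assumes "open S" "x \<in> S" "smooth_on S f"
  shows "D (\<lambda>y. D f y u) x v = D (\<lambda>y. D f y v) x u"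
proof (rule ccontr)
  let ?a = "\<lambda>z. D (\<lambda>y. D f y u) z v" and ?b = "\<lambda>z. D (\<lambda>y. D f y v) z u"
  assume ne: "?a x \<noteq> ?b x"
  \<comment> \<open>If the two mixed derivatives differed at \<open>x\<close>, then near \<open>x\<close> each would stay closer to its own
    value at \<open>x\<close> than half the gap, although both equal the same second difference somewhere there.\<close>
  define c where "c z = dist (?a z) (?a x) + dist (?b z) (?b x)" for z
  have "continuous_on S c"
    unfolding c_def by (intro continuous_intros smooth_on_continuous smooth_on_D assms)
  then have "open (c -` {..<dist (?a x) (?b x) / 2} \<inter> S)"
    by (rule iffD1[OF continuous_on_open_vimage[OF assms(1)], rule_format]) simp
  moreover have "x \<in> c -` {..<dist (?a x) (?b x) / 2} \<inter> S"
    using ne assms(2) by (simp add: c_def)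
  ultimately obtain d where d: "d > 0" "ball x d \<subseteq> c -` {..<dist (?a x) (?b x) / 2} \<inter> S"
    using open_contains_ball by blast
  have bS: "y \<in> S" if "y \<in> ball x d" for y using subsetD[OF d(2) that] by simp
  define h where "h = d / (norm u + norm v + 1)"
  have pos: "norm u + norm v + 1 > 0" by (simp add: add_nonneg_pos)
  then have h: "h > 0" using d(1) by (simp add: h_def)
  have "h * (norm u + norm v) < h * (norm u + norm v + 1)"
    by (rule mult_strict_left_mono) (simp_all add: h)
  also have "\<dots> = d" using pos by (simp add: h_def)
  finally have h': "h * (norm u + norm v) < d" "h * (norm v + norm u) < d"
    by (simp_all add: add.commute)
  have diff: "f differentiable at y" "(\<lambda>z. D f z w) differentiable at y" if "y \<in> ball x d" for y w
    using smooth_on_differentiable[OF assms(3) bS[OF that]]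
      smooth_on_differentiable[OF smooth_on_D[OF assms(3)] bS[OF that]] by simp_all
  obtain z where z: "z \<in> ball x d"
    "f (x + h *\<^sub>R u + h *\<^sub>R v) - f (x + h *\<^sub>R u) - f (x + h *\<^sub>R v) + f x = h^2 * ?a z"
    by (rule mixed_second_difference[OF h h'(1) diff])
  obtain z' where z': "z' \<in> ball x d"
    "f (x + h *\<^sub>R v + h *\<^sub>R u) - f (x + h *\<^sub>R v) - f (x + h *\<^sub>R u) + f x = h^2 * ?b z'"
    by (rule mixed_second_difference[OF h h'(2) diff])
  have "h^2 * ?a z = h^2 * ?b z'"
    unfolding z(2)[symmetric] z'(2)[symmetric] by (simp add: add.commute add.left_commute)
  then have eq: "?a z = ?b z'" using h by simp
  have "c z < dist (?a x) (?b x) / 2" "c z' < dist (?a x) (?b x) / 2"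
    using subsetD[OF d(2) z(1)] subsetD[OF d(2) z'(1)] by simp_all
  moreover have "dist (?a x) (?b x) \<le> dist (?a z) (?a x) + dist (?b z') (?b x)"
    using dist_triangle3[of "?a x" "?b x" "?a z"] eq by simp
  ultimately show False
    using zero_le_dist[of "?b z" "?b x"] zero_le_dist[of "?a z'" "?a x"]
    unfolding c_def by linarith
qed

lemma second_derivative_symmetric:
  fixes f :: "'a::real_normed_vector \<Rightarrow> 'b::euclidean_space"
  assumes "open S" "x \<in> S" "smooth_on S f"
  shows "D (\<lambda>y. D f y u) x v = D (\<lambda>y. D f y v) x u"
proof (rule euclidean_eqI)
  fix b :: 'b assume "b \<in> Basis"
  interpret I: bounded_linear "\<lambda>z. z \<bullet> b" by (rule bounded_linear_inner_left)
  have *: "D (\<lambda>y. D (\<lambda>z. f z \<bullet> b) y u) x v = D (\<lambda>y. D f y u) x v \<bullet> b" for u v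
  proof -
    have "D (\<lambda>y. D (\<lambda>z. f z \<bullet> b) y u) x v = D (\<lambda>y. D f y u \<bullet> b) x v"
      by (rule fun_cong[OF D_cong[OF assms(1,2)]])
        (rule I.D_compose[OF smooth_on_differentiable[OF assms(3)]])
    then show ?thesis
      using I.D_compose[OF smooth_on_differentiable[OF smooth_on_D[OF assms(3)] assms(2)]] by simp
  qed
  show "D (\<lambda>y. D f y u) x v \<bullet> b = D (\<lambda>y. D f y v) x u \<bullet> b"
    using second_derivative_symmetric_real[OF assms(1,2) I.smooth_on_compose[OF assms(1,3)], of u v]
    by (simp add: *)
qed

subsection \<open>Fields of linear maps\<close>

lemma linear_axis_expansion:
  fixes L :: "real ^ 'n \<Rightarrow> 'b::real_vector"
  assumes "linear L"
  shows "L v = (\<Sum>k\<in>UNIV. v $ k *\<^sub>R L (axis k 1))"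
proof -
  have "L v = L (\<Sum>k\<in>UNIV. v $ k *\<^sub>R axis k 1)"
    using basis_expansion[of v] by (simp add: scalar_mult_eq_scaleR)
  then show ?thesis
    by (simp add: linear_sum[OF assms] linear_cmul[OF assms])
qed

text \<open>The Leibniz rule for a field of linear maps that is evaluated on a vector field. Every tensor
  below is treated as such a field, one argument at a time; so only its values on constant vector
  fields ever have to be differentiated.\<close>

lemma has_derivative_linear_field:
  fixes L :: "'a::real_normed_vector \<Rightarrow> real ^ 'n \<Rightarrow> 'b::real_normed_vector"
  assumes "open S" "x \<in> S" "\<And>y. y \<in> S \<Longrightarrow> linear (L y)"
    and L: "\<And>u. (\<lambda>y. L y u) differentiable at x" and e: "e differentiable at x"
  shows "((\<lambda>y. L y (e y)) has_derivative (\<lambda>w. D (\<lambda>y. L y (e x)) x w + L x (D e x w))) (at x)"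
proof -
  let ?a = "\<lambda>k. axis k 1 :: real ^ 'n"
  have exp: "L y v = (\<Sum>k\<in>UNIV. v $ k *\<^sub>R L y (?a k))" if "y \<in> S" for y v
    by (rule linear_axis_expansion[OF assms(3)[OF that]])
  have L': "((\<lambda>y. L y u) has_derivative D (\<lambda>y. L y u) x) (at x)" for u
    using L frechet_derivative_works by blast
  have e': "((\<lambda>y. e y $ k) has_derivative (\<lambda>w. D e x w $ k)) (at x)" for k
    using bounded_linear.has_derivative[OF bounded_linear_vec_nth e[unfolded frechet_derivative_works]] .
  have "((\<lambda>y. \<Sum>k\<in>UNIV. e x $ k *\<^sub>R L y (?a k)) has_derivative
      (\<lambda>w. \<Sum>k\<in>UNIV. e x $ k *\<^sub>R D (\<lambda>y. L y (?a k)) x w)) (at x)"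
    by (rule has_derivative_sum, rule has_derivative_scaleR_right, rule L')
  then have "((\<lambda>y. L y (e x)) has_derivative
      (\<lambda>w. \<Sum>k\<in>UNIV. e x $ k *\<^sub>R D (\<lambda>y. L y (?a k)) x w)) (at x)"
    by (rule has_derivative_transform_within_open[OF _ assms(1,2)]) (rule exp[symmetric])
  note DL = D_eqI[OF this]
  have "((\<lambda>y. \<Sum>k\<in>UNIV. e y $ k *\<^sub>R L y (?a k)) has_derivative
      (\<lambda>w. \<Sum>k\<in>UNIV. e x $ k *\<^sub>R D (\<lambda>y. L y (?a k)) x w + D e x w $ k *\<^sub>R L x (?a k))) (at x)"
    by (rule has_derivative_sum, rule has_derivative_scaleR, rule e', rule L')
  then have "((\<lambda>y. L y (e y)) has_derivative
      (\<lambda>w. \<Sum>k\<in>UNIV. e x $ k *\<^sub>R D (\<lambda>y. L y (?a k)) x w + D e x w $ k *\<^sub>R L x (?a k))) (at x)"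
    by (rule has_derivative_transform_within_open[OF _ assms(1,2)]) (rule exp[symmetric])
  then show ?thesis
    unfolding DL sum.distrib exp[OF assms(2), of "D e x _", symmetric] .
qed

lemmas D_linear_field = has_derivative_linear_field[THEN D_eqI, THEN fun_cong]

lemma smooth_on_linear_field:
  fixes L :: "'a::real_normed_vector \<Rightarrow> real ^ 'n \<Rightarrow> 'b::real_normed_vector"
  assumes "open S" "\<And>y. y \<in> S \<Longrightarrow> linear (L y)" "\<And>u. smooth_on S (\<lambda>y. L y u)" "smooth_on S e"
  shows "smooth_on S (\<lambda>y. L y (e y))"
proof (rule smooth_on_cong[OF assms(1)])
  show "smooth_on S (\<lambda>y. \<Sum>k\<in>UNIV. e y $ k *\<^sub>R L y (axis k 1))"
    by (intro smooth_on_sum smooth_on_scaleR smooth_on_vec_nth assms)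
qed (rule linear_axis_expansion[OF assms(2), symmetric])

lemma linear_D_linear_field:
  fixes L :: "'a::real_normed_vector \<Rightarrow> 'c::real_vector \<Rightarrow> 'b::real_normed_vector"
  assumes "open S" "x \<in> S" "\<And>y. y \<in> S \<Longrightarrow> linear (L y)" "\<And>u. (\<lambda>y. L y u) differentiable at x"
  shows "linear (\<lambda>u. D (\<lambda>y. L y u) x w)"
proof (rule linearI)
  fix a b :: 'c and r :: real
  have "D (\<lambda>y. L y (a + b)) x w = D (\<lambda>y. L y a + L y b) x w"
    by (rule fun_cong[OF D_cong[OF assms(1,2)]]) (rule linear_add[OF assms(3)])
  then show "D (\<lambda>y. L y (a + b)) x w = D (\<lambda>y. L y a) x w + D (\<lambda>y. L y b) x w"
    by (simp add: D_add[OF assms(4) assms(4)])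
  have "D (\<lambda>y. L y (r *\<^sub>R a)) x w = D (\<lambda>y. r *\<^sub>R L y a) x w"
    by (rule fun_cong[OF D_cong[OF assms(1,2)]]) (rule linear_cmul[OF assms(3)])
  then show "D (\<lambda>y. L y (r *\<^sub>R a)) x w = r *\<^sub>R D (\<lambda>y. L y a) x w"
    by (simp add: bounded_linear.D_compose[OF bounded_linear_scaleR_right assms(4)])
qed

section \<open>Orthonormal bases\<close>

locale euclidean_form =
  fixes h :: "real ^ 'n::finite \<Rightarrow> real ^ 'n \<Rightarrow> real"
  assumes bilinear: "bilinear h"
    and sym: "h u v = h v u"
    and pos: "u \<noteq> 0 \<Longrightarrow> h u u > 0"
begin

lemmas h_simps =
  bilinear_ladd[OF bilinear] bilinear_radd[OF bilinear] bilinear_lsub[OF bilinear]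
  bilinear_rsub[OF bilinear] bilinear_lmul[OF bilinear] bilinear_rmul[OF bilinear]
  bilinear_lneg[OF bilinear] bilinear_rneg[OF bilinear]
  bilinear_lzero[OF bilinear] bilinear_rzero[OF bilinear]

lemma linear_left: "linear (\<lambda>u. h u v)" and linear_right: "linear (h u)"
  using bilinear by (auto simp: bilinear_def)

lemma nondegenerate: 
  assumes "\<And>w. h u w = h v w"
  shows "u = v"
  using pos[of "u - v"] assms[of "u - v"] by (auto simp: h_simps)

definition orthonormal :: "('n \<Rightarrow> real ^ 'n) \<Rightarrow> bool" where
  "orthonormal E \<longleftrightarrow> (\<forall>i j. h (E i) (E j) = (if i = j then 1 else 0))"

text \<open>Forming a linear combination of \<open>E\<close> is injective because the form recovers the coefficients, and
  hence surjective because \<open>E\<close> has as many members as there are dimensions.\<close>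

lemma orthonormal_expansion:
  assumes "orthonormal E"
  shows "(\<Sum>i\<in>UNIV. h v (E i) *\<^sub>R E i) = v"
proof -
  define F where "F c = (\<Sum>i\<in>UNIV. c $ i *\<^sub>R E i)" for c :: "real ^ 'n"
  have lin: "linear F"
    by (rule linearI) (simp_all add: F_def scaleR_left_distrib sum.distrib scaleR_sum_right)
  have coeff: "h (F c) (E j) = c $ j" for c j
  proof -
    have on: "h (E i) (E j) = (if i = j then 1 else 0)" for i
      using assms unfolding orthonormal_def by blast
    show ?thesis
      by (simp add: on F_def linear_sum[OF linear_left] h_simps if_distrib cong: if_cong)
  qed
  have "inj F"
    by (metis coeff injI vec_eq_iff)
  then have "surj F"
    using linear_injective_imp_surjective[OF lin] by simp
  then obtain c where "v = F c" by (meson surjD)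
  then show ?thesis
    using coeff by (simp add: F_def)
qed

lemma linear_form_orthonormal:
  assumes "orthonormal E" "linear (l :: _ \<Rightarrow> real)"
  shows "(\<Sum>i\<in>UNIV. l (E i) * h (E i) w) = l w"
proof -
  have flip: "h (E i) w = h w (E i)" for i by (rule sym)
  have "l w = l (\<Sum>i\<in>UNIV. h w (E i) *\<^sub>R E i)"
    by (simp add: orthonormal_expansion[OF assms(1)])
  also have "\<dots> = (\<Sum>i\<in>UNIV. l (E i) * h (E i) w)"
    by (simp add: linear_sum[OF assms(2)] linear_cmul[OF assms(2)] flip mult.commute)
  finally show ?thesis by simp
qed

lemma trace_orthonormal:
  assumes "orthonormal E" "linear L"
  shows "trace (matrix L) = (\<Sum>i\<in>UNIV. h (L (E i)) (E i))"
proof -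
  let ?a = "\<lambda>k. axis k 1 :: real ^ 'n"
  have a: "L (?a k) = (\<Sum>i\<in>UNIV. h (?a k) (E i) *\<^sub>R L (E i))" for k
  proof -
    have "L (?a k) = L (\<Sum>i\<in>UNIV. h (?a k) (E i) *\<^sub>R E i)"
      by (simp add: orthonormal_expansion[OF assms(1)])
    then show ?thesis
      by (simp add: linear_sum[OF assms(2)] linear_cmul[OF assms(2)])
  qed
  have b: "h (L (E i)) (E i) = (\<Sum>k\<in>UNIV. L (E i) $ k * h (?a k) (E i))" for i
    using linear_axis_expansion[OF linear_left, of "L (E i)" "E i"] by simp
  have "trace (matrix L) = (\<Sum>k\<in>UNIV. \<Sum>i\<in>UNIV. h (?a k) (E i) * L (E i) $ k)"
    by (simp add: trace_def matrix_def a)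
  also have "\<dots> = (\<Sum>i\<in>UNIV. \<Sum>k\<in>UNIV. L (E i) $ k * h (?a k) (E i))"
    by (subst sum.swap) (simp add: mult.commute)
  finally show ?thesis by (simp add: b)
qed

end

section \<open>The Levi-Civita connection in a chart\<close>

locale riemannian_chart =
  fixes S :: "(real ^ 'n::finite) set" and G :: "'n metric"
  assumes open_S: "open S"
    and smooth_G: "smooth_on S (\<lambda>x. G x u v)"
    and form: "x \<in> S \<Longrightarrow> euclidean_form (G x)"
begin

lemmas G_sym = euclidean_form.sym[OF form]
lemmas G_simps = euclidean_form.h_simps[OF form]
lemmas linear_G = euclidean_form.linear_left[OF form] euclidean_form.linear_right[OF form]

lemma smooth_G_fields:
  assumes "smooth_on S a" "smooth_on S b"
  shows "smooth_on S (\<lambda>y. G y (a y) (b y))"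
proof (rule smooth_on_linear_field[where L = "\<lambda>y u. G y u (b y)", OF open_S _ _ assms(1)])
  show "linear (\<lambda>u. G y u (b y))" if "y \<in> S" for y using linear_G(1)[OF that] .
  show "smooth_on S (\<lambda>y. G y u (b y))" for u
    by (rule smooth_on_linear_field[OF open_S linear_G(2) smooth_G assms(2)])
qed

lemma frame_orthonormal:
  assumes "orthonormal_frame G V e" "x \<in> V" "x \<in> S"
  shows "euclidean_form.orthonormal (G x) (\<lambda>i. e i x)"
  using assms(1,2) euclidean_form.orthonormal_def[OF form[OF assms(3)]]
  by (simp add: orthonormal_frame_def)

text \<open>Gram-Schmidt orthonormalisation of the coordinate fields, carried out over the whole chart. The
  last clause says that the frame is triangular: it keeps the part of the next coordinate field
  that is orthogonal to the previous frame fields away from zero, since its own coordinate is 1.\<close>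

lemma gram_schmidt:
  fixes I :: "'n set"
  shows "\<exists>e. (\<forall>i\<in>I. smooth_on S (e i)) \<and>
    (\<forall>y\<in>S. \<forall>i\<in>I. \<forall>j\<in>I. G y (e i y) (e j y) = (if i = j then 1 else 0)) \<and>
    (\<forall>y\<in>S. \<forall>i\<in>I. \<forall>j. j \<notin> I \<longrightarrow> e i y $ j = 0)"
    (is "\<exists>e. ?P I e")
proof -
  have "finite I" by simp
  then show ?thesis
  proof (induction I)
    case empty
    show ?case by simp
  next
    case (insert k I)
    then obtain e where sm: "\<And>i. i \<in> I \<Longrightarrow> smooth_on S (e i)"
      and on: "\<And>y i j. y \<in> S \<Longrightarrow> i \<in> I \<Longrightarrow> j \<in> I \<Longrightarrow> G y (e i y) (e j y) = (if i = j then 1 else 0)"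
      and tri: "\<And>y i j. y \<in> S \<Longrightarrow> i \<in> I \<Longrightarrow> j \<notin> I \<Longrightarrow> e i y $ j = 0"
      by blast
    let ?a = "axis k 1 :: real ^ 'n"
    define v where "v y = ?a - (\<Sum>i\<in>I. G y ?a (e i y) *\<^sub>R e i y)" for y
    have smv: "smooth_on S v" unfolding v_def
      by (intro smooth_on_diff smooth_on_const smooth_on_sum smooth_on_scaleR smooth_G_fields open_S sm)
    have vj: "v y $ j = (if j = k then 1 else 0)" if "y \<in> S" "j \<notin> I" for y j
      using that tri by (simp add: v_def axis_def)
    have v0: "v y \<noteq> 0" if "y \<in> S" for y
      using vj[OF that insert.hyps(2)] by auto
    have pos: "G y (v y) (v y) > 0" if "y \<in> S" for y
      using euclidean_form.pos[OF form[OF that] v0[OF that]] .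
    have orth: "G y (v y) (e j y) = 0" if y: "y \<in> S" and j: "j \<in> I" for y j
    proof -
      have "(\<Sum>i\<in>I. G y ?a (e i y) * G y (e i y) (e j y)) = (\<Sum>i\<in>I. if i = j then G y ?a (e i y) else 0)"
        by (rule sum.cong) (simp_all add: on[OF y _ j])
      also have "\<dots> = G y ?a (e j y)" using j insert.hyps(1) by simp
      finally show ?thesis
        by (simp add: v_def G_simps[OF y] linear_sum[OF linear_G(1)[OF y]])
    qed
    define q where "q y = G y (v y) (v y) powr (-1/2)" for y
    have q: "q y * (q y * G y (v y) (v y)) = 1" if "y \<in> S" for y
    proof -
      have "q y * q y = G y (v y) (v y) powr (-1)"
        unfolding q_def powr_add[symmetric] by simp
      then show ?thesis
        using pos[OF that] by (simp add: powr_minus mult.assoc[symmetric])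
    qed
    have smq: "smooth_on S q" unfolding q_def
      by (intro smooth_on_powr smooth_G_fields open_S smv pos)
    define e' where "e' = e(k := \<lambda>y. q y *\<^sub>R v y)"
    have e'k: "e' k = (\<lambda>y. q y *\<^sub>R v y)" and e'i: "i \<in> I \<Longrightarrow> e' i = e i" for i
      using insert.hyps(2) by (auto simp: e'_def)
    have "?P (insert k I) e'"
    proof (intro conjI ballI allI impI)
      fix i assume "i \<in> insert k I"
      then show "smooth_on S (e' i)"
        using sm smooth_on_scaleR[OF open_S smq smv] e'k e'i by auto
    next
      fix y i j assume y: "y \<in> S" and ij: "i \<in> insert k I" "j \<in> insert k I"
      show "G y (e' i y) (e' j y) = (if i = j then 1 else 0)"
      proof (cases "i = k")
        case True
        then show ?thesis
          using ij(2) orth[OF y] q[OF y] insert.hyps(2) by (auto simp: e'k e'i G_simps[OF y])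
      next
        case False
        then show ?thesis
          using ij orth[OF y] on[OF y] G_sym[OF y, of "e i y" "v y"]
          by (auto simp: e'k e'i G_simps[OF y])
      qed
    next
      fix y i j assume "y \<in> S" "i \<in> insert k I" "j \<notin> insert k I"
      then show "e' i y $ j = 0" using tri vj by (auto simp: e'k e'i)
    qed
    then show ?case by blast
  qed
qed

lemma orthonormal_frame_exists: "\<exists>e. orthonormal_frame G S e"
  using gram_schmidt[of UNIV] by (auto simp: orthonormal_frame_def)

text \<open>The Koszul formula: the value of \<open>G (\<Gamma> u v) w\<close> that is forced by symmetry of the connection and
  compatibility with the metric.\<close>

definition koszul :: "real ^ 'n \<Rightarrow> real ^ 'n \<Rightarrow> real ^ 'n \<Rightarrow> real ^ 'n \<Rightarrow> real" where
  "koszul x u v w =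
    (D (\<lambda>y. G y v w) x u + D (\<lambda>y. G y u w) x v - D (\<lambda>y. G y u v) x w) / 2"

lemma linear_D_G:
  assumes "x \<in> S"
  shows "linear (\<lambda>u. D (\<lambda>y. G y u v) x w)" "linear (\<lambda>v. D (\<lambda>y. G y u v) x w)"
    "linear (D (\<lambda>y. G y u v) x)"
proof -
  show "linear (\<lambda>u. D (\<lambda>y. G y u v) x w)"
    by (rule linear_D_linear_field[where L = "\<lambda>y u. G y u v", OF open_S assms])
      (simp_all add: linear_G smooth_on_differentiable[OF smooth_G assms])
  show "linear (\<lambda>v. D (\<lambda>y. G y u v) x w)"
    by (rule linear_D_linear_field[OF open_S assms])
      (simp_all add: linear_G smooth_on_differentiable[OF smooth_G assms])
  show "linear (D (\<lambda>y. G y u v) x)"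
    by (rule smooth_on_linear_D[OF smooth_G assms])
qed

lemma linear_koszul:
  assumes "x \<in> S"
  shows "linear (\<lambda>u. koszul x u v w)" "linear (\<lambda>v. koszul x u v w)" "linear (koszul x u v)"
  by (rule linearI; simp add: koszul_def linear_add[OF linear_D_G(1)[OF assms]]
      linear_add[OF linear_D_G(2)[OF assms]] linear_add[OF linear_D_G(3)[OF assms]]
      linear_cmul[OF linear_D_G(1)[OF assms]] linear_cmul[OF linear_D_G(2)[OF assms]]
      linear_cmul[OF linear_D_G(3)[OF assms]] field_simps)+

lemma koszul_sym: "x \<in> S \<Longrightarrow> koszul x u v w = koszul x v u w"
proof -
  assume "x \<in> S"
  then have "D (\<lambda>y. G y u v) x w = D (\<lambda>y. G y v u) x w"
    by (intro fun_cong[OF D_cong[OF open_S]] G_sym)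
  then show ?thesis by (simp add: koszul_def)
qed

lemma smooth_koszul: "smooth_on S e \<Longrightarrow> smooth_on S (\<lambda>y. koszul y u v (e y))"
proof (rule smooth_on_linear_field[OF open_S linear_koszul(3)])
  have "smooth_on S (\<lambda>y. (1/2) * (D (\<lambda>y. G y v w) y u + D (\<lambda>y. G y u w) y v - D (\<lambda>y. G y u v) y w))"
    for w
    by (intro smooth_on_mult smooth_on_const smooth_on_add smooth_on_diff smooth_on_D smooth_G open_S)
  then show "smooth_on S (\<lambda>y. koszul y u v w)" for w
    by (simp add: koszul_def)
qed

abbreviation \<Gamma> :: "real ^ 'n \<Rightarrow> real ^ 'n \<Rightarrow> real ^ 'n \<Rightarrow> real ^ 'n" where
  "\<Gamma> \<equiv> levi_civita G"

text \<open>The form \<open>koszul x u v\<close> is turned into a vector by an orthonormal basis. Expressing the connection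
  by an orthonormal frame instead of the inverse matrix of the metric also makes its smoothness
  immediate.\<close>

lemma levi_civita_koszul:
  assumes x: "x \<in> S"
  shows "bilinear (\<Gamma> x)" "\<Gamma> x u v = \<Gamma> x v u"
    "D (\<lambda>y. G y u v) x w = G x (\<Gamma> x w u) v + G x u (\<Gamma> x w v)"
    "G x (\<Gamma> x u v) w = koszul x u v w"
proof -
  interpret euclidean_form "G x" using form[OF x] .
  define P where "P C \<longleftrightarrow> bilinear C \<and> (\<forall>u v. C u v = C v u) \<and>
     (\<forall>u v w. D (\<lambda>y. G y u v) x w = G x (C w u) v + G x u (C w v))" for C
  obtain e where e: "orthonormal (\<lambda>i. e i x)"
    using orthonormal_frame_exists frame_orthonormal[OF _ x x] by blast
  have kosz: "G x (C u v) w = koszul x u v w" if "P C" for C u v w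
  proof -
    have s: "C a b = C b a" and d: "D (\<lambda>y. G y a b) x c = G x (C c a) b + G x a (C c b)" for a b c
      using that by (auto simp: P_def)
    show ?thesis
      unfolding koszul_def d
      by (simp add: s[of v u] s[of w u] s[of w v] sym[of v "C u w"])
  qed
  define C where "C u v = (\<Sum>i\<in>UNIV. koszul x u v (e i x) *\<^sub>R e i x)" for u v
  have C: "G x (C u v) w = koszul x u v w" for u v w
  proof -
    have flip: "G x (e i x) w = G x w (e i x)" for i by (rule sym)
    have "G x (C u v) w = (\<Sum>i\<in>UNIV. G x w (e i x) *\<^sub>R koszul x u v (e i x))"
      by (simp add: C_def linear_sum[OF linear_left] h_simps flip mult.commute)
    also have "\<dots> = koszul x u v (\<Sum>i\<in>UNIV. G x w (e i x) *\<^sub>R e i x)"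
      by (simp add: linear_sum[OF linear_koszul(3)[OF x]] linear_cmul[OF linear_koszul(3)[OF x]])
    finally show ?thesis by (simp add: orthonormal_expansion[OF e])
  qed
  have "bilinear C"
    unfolding bilinear_def
    by (intro conjI allI linearI)
      (simp_all add: C_def linear_add[OF linear_koszul(1)[OF x]] linear_add[OF linear_koszul(2)[OF x]]
        linear_cmul[OF linear_koszul(1)[OF x]] linear_cmul[OF linear_koszul(2)[OF x]]
        scaleR_left_distrib sum.distrib scaleR_sum_right)
  moreover have "C u v = C v u" for u v
    by (simp add: C_def koszul_sym[OF x, of u v])
  moreover have "D (\<lambda>y. G y u v) x w = G x (C w u) v + G x u (C w v)" for u v w
  proof -
    have "D (\<lambda>y. G y v u) x w = D (\<lambda>y. G y u v) x w"
      by (intro fun_cong[OF D_cong[OF open_S x]] G_sym)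
    then show ?thesis
      by (simp add: C sym[of u "C w v"] koszul_def field_simps)
  qed
  ultimately have PC: "P C" by (simp add: P_def)
  have "\<Gamma> x = C"
    unfolding levi_civita_def P_def[symmetric]
  proof (rule the_equality)
    show "P C" by (rule PC)
    fix C' assume "P C'"
    then show "C' = C"
      by (intro ext nondegenerate) (simp add: kosz C)
  qed
  then have PG: "P (\<Gamma> x)" using PC by simp
  show "bilinear (\<Gamma> x)" using PG unfolding P_def by blast
  show "\<Gamma> x u v = \<Gamma> x v u" using PG unfolding P_def by blast
  show "D (\<lambda>y. G y u v) x w = G x (\<Gamma> x w u) v + G x u (\<Gamma> x w v)" using PG unfolding P_def by blast
  show "G x (\<Gamma> x u v) w = koszul x u v w" by (rule kosz[OF PG])
qed

lemmas \<Gamma>_sym = levi_civita_koszul(2)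
lemmas \<Gamma>_simps =
  bilinear_ladd[OF levi_civita_koszul(1)] bilinear_radd[OF levi_civita_koszul(1)]
  bilinear_lsub[OF levi_civita_koszul(1)] bilinear_rsub[OF levi_civita_koszul(1)]
  bilinear_lmul[OF levi_civita_koszul(1)] bilinear_rmul[OF levi_civita_koszul(1)]
  bilinear_lzero[OF levi_civita_koszul(1)] bilinear_rzero[OF levi_civita_koszul(1)]

lemma linear_\<Gamma>: 
  assumes "x \<in> S" shows "linear (\<lambda>u. \<Gamma> x u v)" "linear (\<Gamma> x u)"
  using levi_civita_koszul(1)[OF assms] by (auto simp: bilinear_def)

lemma smooth_\<Gamma>: "smooth_on S (\<lambda>y. \<Gamma> y u v)"
proof -
  obtain e where e: "orthonormal_frame G S e" using orthonormal_frame_exists by blast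
  then have sm: "smooth_on S (e i)" for i by (simp add: orthonormal_frame_def)
  show ?thesis
  proof (rule smooth_on_cong[OF open_S])
    show "smooth_on S (\<lambda>y. \<Sum>i\<in>UNIV. koszul y u v (e i y) *\<^sub>R e i y)"
      by (intro smooth_on_sum smooth_on_scaleR smooth_koszul sm open_S)
    show "(\<Sum>i\<in>UNIV. koszul y u v (e i y) *\<^sub>R e i y) = \<Gamma> y u v" if y: "y \<in> S" for y
      using euclidean_form.orthonormal_expansion[OF form[OF y] frame_orthonormal[OF e y y], of "\<Gamma> y u v"]
      by (simp add: levi_civita_koszul(4)[OF y])
  qed
qed

text \<open>Derivatives along constant fields suffice, and they have the advantage that constant fields commute,
  so that no Lie bracket occurs in commutators of \<open>nab u\<close> and \<open>nab v\<close>.\<close>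

abbreviation nab :: "real ^ 'n \<Rightarrow> 'n vfield \<Rightarrow> 'n vfield" where
  "nab u W \<equiv> cov G (\<lambda>_. u) W"

lemma nab_const: "nab u (\<lambda>_. w) x = \<Gamma> x u w"
  by (simp add: cov_def)

lemma smooth_nab:
  assumes "smooth_on S W"
  shows "smooth_on S (nab u W)"
proof -
  have "smooth_on S (\<lambda>x. D W x u + \<Gamma> x u (W x))"
    by (intro smooth_on_add smooth_on_D assms open_S
        smooth_on_linear_field[OF open_S linear_\<Gamma>(2) smooth_\<Gamma> assms])
  then show ?thesis by (simp add: cov_def[abs_def])
qed

lemma linear_nab:
  assumes "smooth_on S W" "x \<in> S"
  shows "linear (\<lambda>u. nab u W x)"
  unfolding cov_def
  by (intro linear_compose_add smooth_on_linear_D[OF assms] linear_\<Gamma>(1) assms)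

lemma D_metric:
  assumes x: "x \<in> S" and ab: "a differentiable at x" "b differentiable at x"
  shows "D (\<lambda>y. G y (a y) (b y)) x w = G x (nab w a x) (b x) + G x (a x) (nab w b x)"
proof -
  note dG = smooth_on_differentiable[OF smooth_G x]
  have Gb: "((\<lambda>y. G y u (b y)) has_derivative (\<lambda>w. D (\<lambda>y. G y u (b x)) x w + G x u (D b x w))) (at x)" for u
    by (rule has_derivative_linear_field[OF open_S x linear_G(2) dG ab(2)])
  then have "D (\<lambda>y. G y (a y) (b y)) x w = D (\<lambda>y. G y (a x) (b y)) x w + G x (D a x w) (b x)"
    by (intro D_linear_field[where L = "\<lambda>y u. G y u (b y)", OF open_S x linear_G(1) _ ab(1)])
      (auto simp: differentiable_def)
  also have "D (\<lambda>y. G y (a x) (b y)) x w = D (\<lambda>y. G y (a x) (b x)) x w + G x (a x) (D b x w)"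
    by (simp add: D_eqI[OF Gb])
  finally show ?thesis
    by (simp add: levi_civita_koszul(3)[OF x] cov_def G_simps[OF x])
qed

section \<open>Curvature\<close>

text \<open>The curvature tensor: on constant fields, the curvature is the commutator of covariant derivatives.\<close>

definition Rm :: "real ^ 'n \<Rightarrow> real ^ 'n \<Rightarrow> real ^ 'n \<Rightarrow> real ^ 'n \<Rightarrow> real ^ 'n" where
  "Rm x u v w = nab u (nab v (\<lambda>_. w)) x - nab v (nab u (\<lambda>_. w)) x"

lemma curvature_const: "curvature G (\<lambda>_. u) (\<lambda>_. v) (\<lambda>_. w) x = Rm x u v w"
  if "x \<in> S"
  by (simp add: curvature_def Rm_def lie_bracket_def[abs_def] nab_const \<Gamma>_simps[OF that])

lemma nab_nab:
  assumes W: "smooth_on S W" and x: "x \<in> S"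
  shows "nab u (nab v W) x = D (\<lambda>y. D W y v) x u + D (\<lambda>y. \<Gamma> y v (W x)) x u
    + \<Gamma> x v (D W x u) + \<Gamma> x u (D W x v) + \<Gamma> x u (\<Gamma> x v (W x))"
proof -
  have d: "(\<lambda>y. \<Gamma> y v w) differentiable at x" for w by (rule smooth_on_differentiable[OF smooth_\<Gamma> x])
  have "((\<lambda>y. \<Gamma> y v (W y)) has_derivative
      (\<lambda>u. D (\<lambda>y. \<Gamma> y v (W x)) x u + \<Gamma> x v (D W x u))) (at x)"
    by (rule has_derivative_linear_field[OF open_S x linear_\<Gamma>(2) d smooth_on_differentiable[OF W x]])
  note * = D_eqI[OF this] 
  have "(\<lambda>y. \<Gamma> y v (W y)) differentiable at x"
    using \<open>(_ has_derivative _) _\<close> by (auto simp: differentiable_def)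
  then have "D (nab v W) x u = D (\<lambda>y. D W y v) x u + D (\<lambda>y. \<Gamma> y v (W y)) x u"
    unfolding cov_def[abs_def]
    by (intro D_add smooth_on_differentiable[OF smooth_on_D[OF W] x])
  then show ?thesis
    by (simp add: cov_def[of G "\<lambda>_. u"] * \<Gamma>_simps[OF x]) (simp add: cov_def \<Gamma>_simps[OF x])
qed

text \<open>The second derivatives of \<open>W\<close> cancel by symmetry and its first derivatives cancel because they enter
  symmetrically in \<open>u\<close> and \<open>v\<close>; so the commutator is tensorial in \<open>W\<close>.\<close>

lemma ricci_identity:
  assumes "smooth_on S W" "x \<in> S"
  shows "nab u (nab v W) x - nab v (nab u W) x = Rm x u v (W x)"
  using second_derivative_symmetric[OF open_S assms(2,1), of u v]
  by (simp add: Rm_def nab_nab[OF assms] nab_nab[OF smooth_on_const assms(2)]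
      \<Gamma>_simps[OF assms(2)])

lemma smooth_Rm: "smooth_on S (\<lambda>y. Rm y u v w)"
  unfolding Rm_def by (intro smooth_on_diff smooth_nab smooth_on_const open_S)

lemma Rm_skew: "Rm x v u w = - Rm x u v w"
  by (simp add: Rm_def)

lemma linear_Rm:
  assumes x: "x \<in> S"
  shows "linear (\<lambda>u. Rm x u v w)" "linear (\<lambda>v. Rm x u v w)" "linear (\<lambda>w. Rm x u v w)"
proof -
  show 1: "linear (\<lambda>u. Rm x u v w)" for v w
  proof -
    have *: "linear (\<lambda>u. D (\<lambda>y. \<Gamma> y u w) x v)"
      by (rule linear_D_linear_field[where L = "\<lambda>y u. \<Gamma> y u w", OF open_S x])
        (simp_all add: linear_\<Gamma> smooth_on_differentiable[OF smooth_\<Gamma> x])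
    have "linear (\<lambda>u. D (\<lambda>y. \<Gamma> y v w) x u)"
      by (rule smooth_on_linear_D[OF smooth_\<Gamma> x])
    then have "linear (\<lambda>u. D (\<lambda>y. \<Gamma> y v w) x u + \<Gamma> x u (\<Gamma> x v w) - (D (\<lambda>y. \<Gamma> y u w) x v + \<Gamma> x v (\<Gamma> x u w)))"
      by (intro linear_compose_sub linear_compose_add * linear_\<Gamma>(1)[OF x]
          linear_compose[OF linear_\<Gamma>(1)[OF x] linear_\<Gamma>(2)[OF x], unfolded o_def])
    then show ?thesis
      by (simp add: Rm_def nab_nab[OF smooth_on_const x] \<Gamma>_simps[OF x])
  qed
  show "linear (\<lambda>v. Rm x u v w)"
    using linear_compose_neg[OF 1[of u w]] by (simp add: Rm_skew[of x u])
  have *: "linear (\<lambda>w. D (\<lambda>y. \<Gamma> y a w) x b)" for a b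
    by (rule linear_D_linear_field[where L = "\<lambda>y. \<Gamma> y a", OF open_S x])
      (simp_all add: linear_\<Gamma> smooth_on_differentiable[OF smooth_\<Gamma> x])
  have "linear (\<lambda>w. D (\<lambda>y. \<Gamma> y v w) x u + \<Gamma> x u (\<Gamma> x v w) - (D (\<lambda>y. \<Gamma> y u w) x v + \<Gamma> x v (\<Gamma> x u w)))"
    by (intro linear_compose_sub linear_compose_add *
        linear_compose[OF linear_\<Gamma>(2)[OF x] linear_\<Gamma>(2)[OF x], unfolded o_def])
  then show "linear (\<lambda>w. Rm x u v w)"
    by (simp add: Rm_def nab_nab[OF smooth_on_const x] \<Gamma>_simps[OF x])
qed

text \<open>The commutator of the derivatives along \<open>u\<close> and \<open>v\<close> annihilates the function \<open>G w z\<close>; since the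
  connection is metric, it also acts on it as a derivation.\<close>

lemma Rm_metric_skew:
  assumes x: "x \<in> S"
  shows "G x (Rm x u v w) z = - G x w (Rm x u v z)"
proof -
  have D2: "D (\<lambda>y. D (\<lambda>y. G y w z) y v) x u
      = G x (nab u (nab v (\<lambda>_. w)) x) z + G x (nab v (\<lambda>_. w) x) (nab u (\<lambda>_. z) x)
      + G x (nab u (\<lambda>_. w) x) (nab v (\<lambda>_. z) x) + G x w (nab u (nab v (\<lambda>_. z)) x)" for u v
  proof -
    have dn: "nab v (\<lambda>_. a) differentiable at x" for a
      by (rule smooth_on_differentiable[OF smooth_nab[OF smooth_on_const] x])
    have "D (\<lambda>y. D (\<lambda>y. G y w z) y v) x u =
        D (\<lambda>y. G y (nab v (\<lambda>_. w) y) z + G y w (nab v (\<lambda>_. z) y)) x u"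
      by (intro fun_cong[OF D_cong[OF open_S x]])
        (simp add: nab_const levi_civita_koszul(3))
    also have "\<dots> = D (\<lambda>y. G y (nab v (\<lambda>_. w) y) z) x u + D (\<lambda>y. G y w (nab v (\<lambda>_. z) y)) x u"
      by (intro D_add smooth_on_differentiable[OF smooth_G_fields x] smooth_nab smooth_on_const)
    finally show ?thesis
      using D_metric[OF x dn, of "\<lambda>_. z" w u] D_metric[OF x _ dn, of "\<lambda>_. w" z u] by simp
  qed
  have "D (\<lambda>y. D (\<lambda>y. G y w z) y v) x u = D (\<lambda>y. D (\<lambda>y. G y w z) y u) x v"
    by (rule second_derivative_symmetric[OF open_S x smooth_G])
  then show ?thesis
    unfolding D2 by (simp add: Rm_def G_simps[OF x])
qed

lemma first_bianchi:
  assumes x: "x \<in> S"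
  shows "Rm x u v w + Rm x v w u + Rm x w u v = 0"
proof -
  have "D (\<lambda>y. \<Gamma> y a b) x c = D (\<lambda>y. \<Gamma> y b a) x c" for a b c
    by (intro fun_cong[OF D_cong[OF open_S x]] \<Gamma>_sym)
  note s = this[of w v u] this[of w u v] this[of u v w]
  show ?thesis
    by (simp add: Rm_def nab_nab[OF smooth_on_const x] \<Gamma>_simps[OF x] s \<Gamma>_sym[OF x, of w v]
        \<Gamma>_sym[OF x, of w u] \<Gamma>_sym[OF x, of v u])
qed

lemma nab_cong: 
  assumes "x \<in> S" "\<And>y. y \<in> S \<Longrightarrow> V y = W y"
  shows "nab u V x = nab u W x"
  by (simp add: cov_def D_cong[OF open_S assms] assms)

lemma nab_diff:
  assumes "smooth_on S V" "smooth_on S W" "x \<in> S"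
  shows "nab u (\<lambda>y. V y - W y) x = nab u V x - nab u W x"
  using smooth_on_differentiable[OF assms(1,3)] smooth_on_differentiable[OF assms(2,3)]
  by (simp add: cov_def D_diff \<Gamma>_simps[OF assms(3)])

definition nabla_Rm ::
    "real ^ 'n \<Rightarrow> real ^ 'n \<Rightarrow> real ^ 'n \<Rightarrow> real ^ 'n \<Rightarrow> real ^ 'n \<Rightarrow> real ^ 'n" where
  "nabla_Rm x z u v w = nab z (\<lambda>y. Rm y u v w) x
    - Rm x (\<Gamma> x z u) v w - Rm x u (\<Gamma> x z v) w - Rm x u v (\<Gamma> x z w)"

text \<open>The Jacobi identity for the operators \<open>nab z\<close>, \<open>nab u\<close>, \<open>nab v\<close>. The corrections from the connection
  in the first two arguments of the curvature cancel because the connection is torsion-free.\<close>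

lemma second_bianchi:
  assumes x: "x \<in> S"
  shows "nabla_Rm x z u v w + nabla_Rm x u v z w + nabla_Rm x v z u w = 0"
proof -
  let ?N = "\<lambda>a b c. nab a (nab b (nab c (\<lambda>_. w))) x"
  note sm = smooth_nab smooth_on_const
  have eq: "nabla_Rm x a b c w = ?N a b c - ?N a c b - (?N b c a - ?N c b a)
      - Rm x (\<Gamma> x a b) c w - Rm x b (\<Gamma> x a c) w" for a b c
  proof -
    have "Rm x b c (\<Gamma> x a w) = ?N b c a - ?N c b a"
      using ricci_identity[of "nab a (\<lambda>_. w)" x b c] x by (simp add: sm nab_const)
    moreover have "nab a (\<lambda>y. Rm y b c w) x = ?N a b c - ?N a c b"
      unfolding Rm_def by (intro nab_diff sm x)
    ultimately show ?thesis by (simp add: nabla_Rm_def)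
  qed
  show ?thesis
    unfolding eq
    by (simp add: \<Gamma>_sym[OF x, of v u] \<Gamma>_sym[OF x, of v z] \<Gamma>_sym[OF x, of z u]
        Rm_skew[of x z] Rm_skew[of x v "\<Gamma> x u z"] Rm_skew[of x u "\<Gamma> x z v"])
qed

lemma nabla_Rm_skew: "x \<in> S \<Longrightarrow> nabla_Rm x z v u w = - nabla_Rm x z u v w"
proof -
  assume x: "x \<in> S"
  have "nab z (\<lambda>y. Rm y v u w) x = nab z (\<lambda>y. 0 - Rm y u v w) x"
    by (rule nab_cong[OF x]) (simp add: Rm_skew[of _ u])
  also have "\<dots> = - nab z (\<lambda>y. Rm y u v w) x"
    using nab_diff[OF smooth_on_const smooth_Rm x, of z 0] by (simp add: nab_const \<Gamma>_simps[OF x])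
  finally show ?thesis
    by (simp add: nabla_Rm_def Rm_skew[of x v] Rm_skew[of x "\<Gamma> x z v"])
qed

lemma nabla_Rm_metric_skew:
  assumes x: "x \<in> S"
  shows "G x (nabla_Rm x z u v w) a = - G x w (nabla_Rm x z u v a)"
proof -
  have d: "(\<lambda>y. Rm y u v b) differentiable at x" for b
    by (rule smooth_on_differentiable[OF smooth_Rm x])
  have "D (\<lambda>y. G y (Rm y u v w) a) x z = D (\<lambda>y. 0 - G y w (Rm y u v a)) x z"
    by (intro fun_cong[OF D_cong[OF open_S x]]) (simp add: Rm_metric_skew)
  also have "\<dots> = - D (\<lambda>y. G y w (Rm y u v a)) x z"
    using D_diff[OF differentiable_const smooth_on_differentiable[OF smooth_G_fields[OF smooth_on_const smooth_Rm] x],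
        of 0] by simp
  finally have "G x (nab z (\<lambda>y. Rm y u v w) x) a + G x (Rm x u v w) (\<Gamma> x z a)
      = - (G x (\<Gamma> x z w) (Rm x u v a) + G x w (nab z (\<lambda>y. Rm y u v a) x))"
    using D_metric[OF x d, of "\<lambda>_. a" w z] D_metric[OF x _ d, of "\<lambda>_. w" a z]
    by (simp add: nab_const)
  then show ?thesis
    using Rm_metric_skew[OF x, of u v w "\<Gamma> x z a"] Rm_metric_skew[OF x, of u v "\<Gamma> x z w" a]
      Rm_metric_skew[OF x, of "\<Gamma> x z u" v w a] Rm_metric_skew[OF x, of u "\<Gamma> x z v" w a]
    by (simp add: nabla_Rm_def G_simps[OF x])
qed

section \<open>Ricci curvature and the contracted Bianchi identity\<close>

lemma ricci_trace: "x \<in> S \<Longrightarrow> ricci G x u v = trace (matrix (\<lambda>w. Rm x w u v))"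
  by (simp add: ricci_def curvature_const)

lemma ricci_orthonormal:
  assumes "x \<in> S" "euclidean_form.orthonormal (G x) E"
  shows "ricci G x u v = (\<Sum>i\<in>UNIV. G x (Rm x (E i) u v) (E i))"
  using euclidean_form.trace_orthonormal[OF form[OF assms(1)] assms(2) linear_Rm(1)[OF assms(1)]]
  by (simp add: ricci_trace[OF assms(1)])

lemma exists_orthonormal_basis:
  assumes "x \<in> S" 
  obtains E where "euclidean_form.orthonormal (G x) E"
  using orthonormal_frame_exists frame_orthonormal[OF _ assms assms] by blast

text \<open>By the first Bianchi identity, the antisymmetric part of the Ricci tensor is the trace of a curvature
  operator \<open>Rm x u v\<close>, and this operator is skew.\<close>

lemma ricci_sym:
  assumes x: "x \<in> S"
  shows "ricci G x u v = ricci G x v u"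
proof -
  obtain E where E: "euclidean_form.orthonormal (G x) E" by (rule exists_orthonormal_basis[OF x])
  have "G x (Rm x (E i) u v) (E i) = G x (Rm x (E i) v u) (E i)" for i
  proof -
    have "Rm x (E i) u v = Rm x (E i) v u - Rm x u v (E i)"
    proof -
      have "Rm x (E i) u v + (Rm x u v (E i) + Rm x v (E i) u) = 0"
        using first_bianchi[OF x, of "E i" u v] by (simp add: add.assoc)
      then have "Rm x (E i) u v = - (Rm x u v (E i) + Rm x v (E i) u)"
        by (simp only: eq_neg_iff_add_eq_0)
      then show ?thesis by (simp add: Rm_skew[of x v "E i"])
    qed
    moreover have "G x (Rm x u v (E i)) (E i) = 0"
      using Rm_metric_skew[OF x, of u v "E i" "E i"] G_sym[OF x, of "E i" "Rm x u v (E i)"] by simp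
    ultimately show ?thesis by (simp add: G_simps[OF x])
  qed
  then show ?thesis by (simp add: ricci_orthonormal[OF x E])
qed

lemma linear_trace_matrix: 
  fixes L :: "'c::real_vector \<Rightarrow> real ^ 'm::finite \<Rightarrow> real ^ 'm"
  assumes "\<And>w. linear (\<lambda>u. L u w)"
  shows "linear (\<lambda>u. trace (matrix (L u)))"
  by (rule linearI)
    (simp_all add: trace_def matrix_def linear_add[OF assms] linear_cmul[OF assms] sum.distrib sum_distrib_left)

lemma linear_ricci:
  assumes x: "x \<in> S"
  shows "linear (ricci G x u)" "linear (\<lambda>u. ricci G x u v)"
  unfolding ricci_trace[OF x, abs_def]
  by (intro linear_trace_matrix linear_Rm x)+

lemma smooth_ricci: "smooth_on S (\<lambda>y. ricci G y u v)"
proof (rule smooth_on_cong[OF open_S])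
  show "smooth_on S (\<lambda>y. \<Sum>k\<in>UNIV. Rm y (axis k 1) u v $ k)"
    by (intro smooth_on_sum smooth_on_vec_nth smooth_Rm open_S)
qed (simp add: ricci_trace trace_def matrix_def)

lemma ricci_operator:
  assumes x: "x \<in> S"
  shows "G x (ricci_operator G x u) v = ricci G x u v"
proof -
  interpret euclidean_form "G x" using form[OF x] .
  obtain E where E: "orthonormal E" by (rule exists_orthonormal_basis[OF x])
  let ?q = "\<Sum>i\<in>UNIV. ricci G x u (E i) *\<^sub>R E i"
  have q: "G x ?q v = ricci G x u v" for v
  proof -
    have flip: "G x (E i) v = G x v (E i)" for i by (rule sym)
    have "G x ?q v = ricci G x u (\<Sum>i\<in>UNIV. G x v (E i) *\<^sub>R E i)"
      by (simp add: linear_sum[OF linear_left] linear_sum[OF linear_ricci(1)[OF x]]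
          linear_cmul[OF linear_ricci(1)[OF x]] h_simps flip mult.commute)
    then show ?thesis by (simp add: orthonormal_expansion[OF E])
  qed
  have "ricci_operator G x u = ?q"
    unfolding ricci_operator_def
  proof (rule the_equality)
    show "\<forall>v. G x ?q v = ricci G x u v" using q by blast
    fix w assume "\<forall>v. G x w v = ricci G x u v"
    then show "w = ?q" by (intro nondegenerate) (simp add: q)
  qed
  then show ?thesis using q by simp
qed

lemma scalar_curvature_orthonormal:
  assumes x: "x \<in> S" and E: "euclidean_form.orthonormal (G x) E"
  shows "scalar_curvature G x = (\<Sum>i\<in>UNIV. ricci G x (E i) (E i))"
proof -
  have "linear (ricci_operator G x)"
  proof (rule linearI)
    show "ricci_operator G x (a + b) = ricci_operator G x a + ricci_operator G x b" for a b
      by (rule euclidean_form.nondegenerate[OF form[OF x]])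
        (simp add: ricci_operator[OF x] G_simps[OF x] linear_add[OF linear_ricci(2)[OF x]])
    show "ricci_operator G x (c *\<^sub>R a) = c *\<^sub>R ricci_operator G x a" for a c
      by (rule euclidean_form.nondegenerate[OF form[OF x]])
        (simp add: ricci_operator[OF x] G_simps[OF x] linear_cmul[OF linear_ricci(2)[OF x]])
  qed
  then show ?thesis
    using euclidean_form.trace_orthonormal[OF form[OF x] E]
    by (simp add: scalar_curvature_def ricci_operator[OF x])
qed

lemma smooth_ricci_fields:
  assumes "smooth_on S a" "smooth_on S b"
  shows "smooth_on S (\<lambda>y. ricci G y (a y) (b y))"
proof (rule smooth_on_linear_field[where L = "\<lambda>y u. ricci G y u (b y)", OF open_S _ _ assms(1)])
  show "linear (\<lambda>u. ricci G y u (b y))" if "y \<in> S" for y using linear_ricci(2)[OF that] .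
  show "smooth_on S (\<lambda>y. ricci G y u (b y))" for u
    by (rule smooth_on_linear_field[OF open_S linear_ricci(1) smooth_ricci assms(2)])
qed

lemma smooth_scalar_curvature: "smooth_on S (scalar_curvature G)"
proof -
  obtain e where e: "orthonormal_frame G S e" using orthonormal_frame_exists by blast
  then have sm: "smooth_on S (e i)" for i by (simp add: orthonormal_frame_def)
  show ?thesis
  proof (rule smooth_on_cong[OF open_S])
    show "smooth_on S (\<lambda>y. \<Sum>i\<in>UNIV. ricci G y (e i y) (e i y))"
      by (intro smooth_on_sum smooth_ricci_fields sm open_S)
  qed (simp add: scalar_curvature_orthonormal[OF _ frame_orthonormal[OF e]])
qed

definition nabla_Ric :: "real ^ 'n \<Rightarrow> real ^ 'n \<Rightarrow> real ^ 'n \<Rightarrow> real ^ 'n \<Rightarrow> real" where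
  "nabla_Ric x z u v = D (\<lambda>y. ricci G y u v) x z
    - ricci G x (\<Gamma> x z u) v - ricci G x u (\<Gamma> x z v)"

lemma D_ricci_fields:
  assumes x: "x \<in> S" and ab: "smooth_on S a" "smooth_on S b"
  shows "D (\<lambda>y. ricci G y (a y) (b y)) x z = nabla_Ric x z (a x) (b x)
    + ricci G x (nab z a x) (b x) + ricci G x (a x) (nab z b x)"
proof -
  note d = smooth_on_differentiable[OF _ x]
  have "D (\<lambda>y. ricci G y (a y) (b y)) x z
      = D (\<lambda>y. ricci G y (a x) (b y)) x z + ricci G x (D a x z) (b x)"
    by (rule D_linear_field[where L = "\<lambda>y u. ricci G y u (b y)",
          OF open_S x linear_ricci(2) d[OF smooth_ricci_fields[OF smooth_on_const ab(2)]] d[OF ab(1)]])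
  also have "D (\<lambda>y. ricci G y (a x) (b y)) x z = D (\<lambda>y. ricci G y (a x) (b x)) x z + ricci G x (a x) (D b x z)"
    by (rule D_linear_field[where L = "\<lambda>y. ricci G y (a x)",
          OF open_S x linear_ricci(1) d[OF smooth_ricci] d[OF ab(2)]])
  finally show ?thesis
    by (simp add: nabla_Ric_def cov_def linear_add[OF linear_ricci(1)[OF x]] linear_add[OF linear_ricci(2)[OF x]])
qed

text \<open>A trace of an endomorphism commutes with covariant differentiation, because the connection enters
  the derivative of the endomorphism through a commutator, which is traceless.\<close>

lemma nabla_Ric_trace:
  assumes x: "x \<in> S"
  shows "nabla_Ric x z u v = trace (matrix (\<lambda>w. nabla_Rm x z w u v))"
proof -
  let ?tr = "\<lambda>L :: real ^ 'n \<Rightarrow> real ^ 'n. trace (matrix L)"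
  have tr: "?tr L = (\<Sum>k\<in>UNIV. L (axis k 1) $ k)" for L by (simp add: trace_def matrix_def)
  have ric: "ricci G y u v = (\<Sum>k\<in>UNIV. Rm y (axis k 1) u v $ k)" if "y \<in> S" for y u v
    unfolding ricci_trace[OF that] by (rule tr)
  have "D (\<lambda>y. ricci G y u v) x z = D (\<lambda>y. \<Sum>k\<in>UNIV. Rm y (axis k 1) u v $ k) x z"
    by (rule fun_cong[OF D_cong[OF open_S x ric]])
  also have "\<dots> = (\<Sum>k\<in>UNIV. D (\<lambda>y. Rm y (axis k 1) u v $ k) x z)"
    by (rule D_sum) (rule smooth_on_differentiable[OF smooth_on_vec_nth[OF open_S smooth_Rm] x])
  also have "\<dots> = (\<Sum>k\<in>UNIV. D (\<lambda>y. Rm y (axis k 1) u v) x z $ k)"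
    by (intro sum.cong refl bounded_linear.D_compose[OF bounded_linear_vec_nth]
        smooth_on_differentiable[OF smooth_Rm x])
  finally have 1: "D (\<lambda>y. ricci G y u v) x z = (\<Sum>k\<in>UNIV. D (\<lambda>y. Rm y (axis k 1) u v) x z $ k)" .
  have "?tr (\<Gamma> x z \<circ> (\<lambda>w. Rm x w u v)) = ?tr ((\<lambda>w. Rm x w u v) \<circ> \<Gamma> x z)"
    unfolding matrix_compose[OF linear_Rm(1)[OF x, of u v] linear_\<Gamma>(2)[OF x, of z]]
      matrix_compose[OF linear_\<Gamma>(2)[OF x, of z] linear_Rm(1)[OF x, of u v]]
    by (rule trace_mul_sym)
  then have 2: "(\<Sum>k\<in>UNIV. \<Gamma> x z (Rm x (axis k 1) u v) $ k) = (\<Sum>k\<in>UNIV. Rm x (\<Gamma> x z (axis k 1)) u v $ k)"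
    unfolding tr o_def .
  show ?thesis
    unfolding tr nabla_Ric_def 1 ric[OF x] nabla_Rm_def cov_def
    by (simp add: sum.distrib sum_subtractf 2)
qed

lemma linear_nabla_Rm:
  assumes x: "x \<in> S"
  shows "linear (\<lambda>u. nabla_Rm x z u v w)"
proof -
  have "linear (\<lambda>u. D (\<lambda>y. Rm y u v w) x z)"
    by (rule linear_D_linear_field[where L = "\<lambda>y u. Rm y u v w", OF open_S x])
      (simp_all add: linear_Rm smooth_on_differentiable[OF smooth_Rm x])
  moreover have "linear (\<lambda>u. \<Gamma> x z (Rm x u v w))"
    by (rule linear_compose[OF linear_Rm(1)[OF x] linear_\<Gamma>(2)[OF x], unfolded o_def])
  moreover have "linear (\<lambda>u. Rm x (\<Gamma> x z u) v w)"
    by (rule linear_compose[OF linear_\<Gamma>(2)[OF x] linear_Rm(1)[OF x], unfolded o_def])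
  ultimately show ?thesis
    unfolding nabla_Rm_def cov_def
    by (intro linear_compose_sub linear_compose_add linear_Rm(1)[OF x])
qed

lemma nabla_Ric_orthonormal:
  assumes "x \<in> S" "euclidean_form.orthonormal (G x) E"
  shows "(\<Sum>i\<in>UNIV. G x (nabla_Rm x z (E i) u v) (E i)) = nabla_Ric x z u v"
  using euclidean_form.trace_orthonormal[OF form[OF assms(1)] assms(2) linear_nabla_Rm[OF assms(1)]]
  by (simp add: nabla_Ric_trace[OF assms(1)])

text \<open>The derivatives of an orthonormal frame have a skew matrix with respect to the frame. It contributes
  nothing when it is contracted with the symmetric Ricci tensor.\<close>

lemma D_scalar_curvature:
  assumes x: "x \<in> S" and e: "orthonormal_frame G S e"
  shows "D (scalar_curvature G) x z = (\<Sum>i\<in>UNIV. nabla_Ric x z (e i x) (e i x))"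
proof -
  interpret euclidean_form "G x" using form[OF x] .
  have on: "orthonormal (\<lambda>i. e i x)" by (rule frame_orthonormal[OF e x x])
  have sm: "smooth_on S (e i)" for i using e by (simp add: orthonormal_frame_def)
  let ?w = "\<lambda>i. nab z (e i) x"
  have skew: "G x (?w i) (e j x) = - G x (?w j) (e i x)" for i j
  proof -
    have "D (\<lambda>y. G y (e i y) (e j y)) x z = D (\<lambda>_. if i = j then 1 else 0) x z"
      using e by (intro fun_cong[OF D_cong[OF open_S x]]) (simp add: orthonormal_frame_def)
    then have "G x (?w i) (e j x) + G x (e i x) (?w j) = 0"
      using D_metric[OF x smooth_on_differentiable[OF sm x] smooth_on_differentiable[OF sm x], of i j z]
      by simp
    then show ?thesis using sym[of "e i x" "?w j"] by simp
  qed
  have wexp: "?w i = (\<Sum>j\<in>UNIV. G x (?w i) (e j x) *\<^sub>R e j x)" for i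
    by (rule orthonormal_expansion[OF on, symmetric])
  let ?Q = "\<Sum>i\<in>UNIV. \<Sum>j\<in>UNIV. G x (?w i) (e j x) * ricci G x (e i x) (e j x)"
  have "?Q = (\<Sum>i\<in>UNIV. \<Sum>j\<in>UNIV. G x (?w j) (e i x) * ricci G x (e j x) (e i x))"
    by (rule sum.swap)
  also have "\<dots> = - ?Q"
    unfolding sum_negf[symmetric]
  proof (intro sum.cong refl)
    fix i j
    show "G x (?w j) (e i x) * ricci G x (e j x) (e i x) = - (G x (?w i) (e j x) * ricci G x (e i x) (e j x))"
      using skew[of j i] ricci_sym[OF x, of "e j x" "e i x"] by simp
  qed
  finally have Q: "?Q = 0" by simp
  have r: "ricci G x (e i x) (?w i) = (\<Sum>j\<in>UNIV. G x (?w i) (e j x) * ricci G x (e i x) (e j x))" for i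
  proof -
    have "ricci G x (e i x) (?w i) = ricci G x (e i x) (\<Sum>j\<in>UNIV. G x (?w i) (e j x) *\<^sub>R e j x)"
      by (rule arg_cong[OF wexp])
    then show ?thesis
      by (simp add: linear_sum[OF linear_ricci(1)[OF x]] linear_cmul[OF linear_ricci(1)[OF x]])
  qed
  have "D (scalar_curvature G) x z = D (\<lambda>y. \<Sum>i\<in>UNIV. ricci G y (e i y) (e i y)) x z"
    by (intro fun_cong[OF D_cong[OF open_S x]] scalar_curvature_orthonormal frame_orthonormal[OF e])
  also have "\<dots> = (\<Sum>i\<in>UNIV. D (\<lambda>y. ricci G y (e i y) (e i y)) x z)"
    by (intro D_sum smooth_on_differentiable[OF _ x] smooth_ricci_fields sm)
  also have "\<dots> = (\<Sum>i\<in>UNIV. nabla_Ric x z (e i x) (e i x) + 2 * ricci G x (e i x) (?w i))"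
    using ricci_sym[OF x, of "?w _" "e _ x"] by (simp add: D_ricci_fields[OF x sm sm] add.commute)
  also have "\<dots> = (\<Sum>i\<in>UNIV. nabla_Ric x z (e i x) (e i x))"
    using Q by (simp add: sum.distrib sum_distrib_left[symmetric] r)
  finally show ?thesis .
qed

text \<open>Contracting the second Bianchi identity twice: the first term gives the derivative of the scalar
  curvature, and each of the other two gives minus the divergence of the Ricci tensor, once by skewness
  in the last two arguments and once by skewness in the first two.\<close>

lemma contracted_bianchi:
  assumes x: "x \<in> S" and e: "orthonormal_frame G S e"
  shows "D (scalar_curvature G) x z = 2 * (\<Sum>i\<in>UNIV. nabla_Ric x (e i x) z (e i x))"
proof -
  let ?E = "\<lambda>i. e i x" and ?N = "nabla_Rm x"
  have on: "euclidean_form.orthonormal (G x) ?E" by (rule frame_orthonormal[OF e x x])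
  note ric = nabla_Ric_orthonormal[OF x on]
  have third: "(\<Sum>i\<in>UNIV. G x (?N (?E j) z (?E i) (?E j)) (?E i)) = - nabla_Ric x (?E j) z (?E j)" for j
    using ric[of "?E j" z "?E j"]
    by (simp add: nabla_Rm_skew[OF x, of "?E j" _ z] G_simps[OF x] sum_negf)
  have second: "(\<Sum>j\<in>UNIV. G x (?N (?E i) (?E j) z (?E j)) (?E i)) = - nabla_Ric x (?E i) z (?E i)" for i
  proof -
    have "G x (?N (?E i) (?E j) z (?E j)) (?E i) = - G x (?N (?E i) (?E j) z (?E i)) (?E j)" for j
      by (simp add: nabla_Rm_metric_skew[OF x, of "?E i" "?E j" z "?E j" "?E i"]
          G_sym[OF x, of "?E j"])
    then show ?thesis using ric[of "?E i" z "?E i"] by (simp add: sum_negf)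
  qed
  have "0 = (\<Sum>j\<in>UNIV. \<Sum>i\<in>UNIV. G x (?N z (?E i) (?E j) (?E j) + ?N (?E i) (?E j) z (?E j)
      + ?N (?E j) z (?E i) (?E j)) (?E i))"
    by (simp add: second_bianchi[OF x] G_simps[OF x])
  also have "\<dots> = (\<Sum>j\<in>UNIV. \<Sum>i\<in>UNIV. G x (?N z (?E i) (?E j) (?E j)) (?E i))
      + (\<Sum>i\<in>UNIV. \<Sum>j\<in>UNIV. G x (?N (?E i) (?E j) z (?E j)) (?E i))
      + (\<Sum>j\<in>UNIV. \<Sum>i\<in>UNIV. G x (?N (?E j) z (?E i) (?E j)) (?E i))"
    by (simp add: G_simps[OF x] sum.distrib
        sum.swap[of "\<lambda>i j. G x (?N (?E i) (?E j) z (?E j)) (?E i)"])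
  finally show ?thesis
    by (simp add: ric second third D_scalar_curvature[OF x e] sum_negf)
qed

section \<open>Conformal vector fields\<close>

text \<open>The second covariant derivative. Unlike \<open>nab u (nab v W)\<close>, it is a tensor in \<open>u\<close> and \<open>v\<close>.\<close>

definition nab2 :: "real ^ 'n \<Rightarrow> real ^ 'n \<Rightarrow> 'n vfield \<Rightarrow> real ^ 'n \<Rightarrow> real ^ 'n" where
  "nab2 u v W x = nab u (nab v W) x - nab (\<Gamma> x u v) W x"

lemma nab2_commute:
  assumes "smooth_on S W" "x \<in> S"
  shows "nab2 u v W x - nab2 v u W x = Rm x u v (W x)"
  using ricci_identity[OF assms, of u v] \<Gamma>_sym[OF assms(2), of v u] by (simp add: nab2_def)

text \<open>Subtracting the derivative along \<open>\<nabla>\<^sub>e e\<close> removes the derivatives of the frame, so that the frame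
  chosen in the definition of the Laplacian matters only through its values at the point.\<close>

lemma vector_laplacian_nab2:
  assumes W: "smooth_on S W" and x: "x \<in> S"
  obtains E where "euclidean_form.orthonormal (G x) E"
    "vector_laplacian G W x = (\<Sum>i\<in>UNIV. nab2 (E i) (E i) W x)"
proof -
  define e where "e = (SOME e. \<exists>V. open V \<and> x \<in> V \<and> orthonormal_frame G V e)"
  have "\<exists>e V. open V \<and> x \<in> V \<and> orthonormal_frame G V e"
    using orthonormal_frame_exists open_S x by blast
  then have "\<exists>V. open V \<and> x \<in> V \<and> orthonormal_frame G V e"
    unfolding e_def by (rule someI_ex)
  then obtain V where V: "x \<in> V" "orthonormal_frame G V e" by blast
  have de: "e i differentiable at x" for i
    using V by (intro smooth_on_differentiable) (auto simp: orthonormal_frame_def)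
  have cov: "cov G X Y y = nab (X y) Y y" for X Y y by (simp add: cov_def)
  have "cov G (e i) (cov G (e i) W) x - cov G (cov G (e i) (e i)) W x = nab2 (e i x) (e i x) W x" for i
  proof -
    have "D (\<lambda>y. nab (e i y) W y) x w = D (nab (e i x) W) x w + nab (D (e i) x w) W x" for w
      by (rule D_linear_field[where L = "\<lambda>y u. nab u W y", OF open_S x linear_nab[OF W]
            smooth_on_differentiable[OF smooth_nab[OF W] x] de])
    then have "cov G (e i) (cov G (e i) W) x
        = nab (e i x) (nab (e i x) W) x + nab (D (e i) x (e i x)) W x"
      unfolding cov[of "e i" W, abs_def] by (simp add: cov_def)
    moreover have "cov G (cov G (e i) (e i)) W x
        = nab (D (e i) x (e i x)) W x + nab (\<Gamma> x (e i x) (e i x)) W x"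
      unfolding cov[of "cov G (e i) (e i)"]
      by (subst cov_def[of G "e i"]) (rule linear_add[OF linear_nab[OF W x]])
    ultimately show ?thesis by (simp add: nab2_def)
  qed
  then have "vector_laplacian G W x = (\<Sum>i\<in>UNIV. nab2 (e i x) (e i x) W x)"
    by (simp add: vector_laplacian_def Let_def e_def[symmetric])
  then show ?thesis using that frame_orthonormal[OF V(2,1) x] by blast
qed

end

text \<open>The last assumption says that half the Lie derivative of the metric along \<open>\<xi>\<close> is \<open>f\<close> times the metric;
  see \<open>lie_derivative_nab\<close>.\<close>

locale conformal_field = riemannian_chart S G for S :: "(real ^ 'n::finite) set" and G +
  fixes \<xi> :: "'n vfield" and f :: "real ^ 'n \<Rightarrow> real"
  assumes smooth_\<xi>: "smooth_on S \<xi>" and smooth_f: "smooth_on S f"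
    and conformal: "x \<in> S \<Longrightarrow> G x (nab u \<xi> x) v + G x u (nab v \<xi> x) = 2 * f x * G x u v"
begin

text \<open>The derivative of the conformal equation: \<open>\<nabla>\<xi>\<close> is \<open>f\<close> times the identity plus a skew part, so the
  symmetric part of its derivative along \<open>w\<close> is the derivative of \<open>f\<close> times the identity.\<close>

lemma conformal_nab2:
  assumes x: "x \<in> S"
  shows "G x (nab2 w u \<xi> x) v + G x u (nab2 w v \<xi> x) = 2 * D f x w * G x u v"
proof -
  have dn: "nab a \<xi> differentiable at x" for a
    by (rule smooth_on_differentiable[OF smooth_nab[OF smooth_\<xi>] x])
  have df: "(\<lambda>y. 2 * f y) differentiable at x"
    by (intro smooth_on_differentiable[OF _ x] smooth_on_mult smooth_on_const smooth_f open_S)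
  have "D (\<lambda>y. 2 * f y) x w = 2 * D f x w"
    by (rule bounded_linear.D_compose[OF bounded_linear_mult_right smooth_on_differentiable[OF smooth_f x]])
  then have "D (\<lambda>y. 2 * f y * G y u v) x w
      = 2 * f x * D (\<lambda>y. G y u v) x w + 2 * D f x w * G x u v"
    using bounded_bilinear.D_prod[OF bounded_bilinear_mult df smooth_on_differentiable[OF smooth_G x], of u v w]
    by simp
  moreover have "D (\<lambda>y. 2 * f y * G y u v) x w
      = D (\<lambda>y. G y (nab u \<xi> y) v + G y u (nab v \<xi> y)) x w"
    by (rule fun_cong[OF D_cong[OF open_S x]]) (simp add: conformal)
  moreover have "\<dots> = D (\<lambda>y. G y (nab u \<xi> y) v) x w + D (\<lambda>y. G y u (nab v \<xi> y)) x w"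
    by (intro D_add smooth_on_differentiable[OF _ x] smooth_G_fields smooth_on_const smooth_nab smooth_\<xi>)
  ultimately have "G x (nab w (nab u \<xi>) x) v + G x (nab u \<xi> x) (\<Gamma> x w v)
      + (G x (\<Gamma> x w u) (nab v \<xi> x) + G x u (nab w (nab v \<xi>) x))
      = 2 * f x * (G x (\<Gamma> x w u) v + G x u (\<Gamma> x w v)) + 2 * D f x w * G x u v"
    using D_metric[OF x dn, of "\<lambda>_. v" u w] D_metric[OF x _ dn, of "\<lambda>_. u" v w]
      levi_civita_koszul(3)[OF x, of u v w]
    by (simp add: nab_const)
  then show ?thesis
    using conformal[OF x, of "\<Gamma> x w u" v] conformal[OF x, of u "\<Gamma> x w v"]
    by (simp add: nab2_def G_simps[OF x] distrib_left)
qed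

text \<open>Yano's formula \<open>\<Delta>\<xi> + Q\<xi> + (n - 2) \<nabla>f = 0\<close> for a conformal field. With \<open>conformal_nab2\<close>, the
  two entries of \<open>G (nab2 e e \<xi>) w\<close> outside the first slot are exchanged; then \<open>nab2_commute\<close> moves
  \<open>w\<close> into the first slot at the price of a curvature term whose trace is the Ricci curvature.\<close>

lemma laplacian_conformal:
  assumes x: "x \<in> S"
  shows "G x (vector_laplacian G \<xi> x) w + ricci G x (\<xi> x) w + (real CARD('n) - 2) * D f x w = 0"
proof -
  interpret euclidean_form "G x" using form[OF x] .
  obtain E where E: "orthonormal E"
    "vector_laplacian G \<xi> x = (\<Sum>i\<in>UNIV. nab2 (E i) (E i) \<xi> x)"
    by (rule vector_laplacian_nab2[OF smooth_\<xi> x])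
  have "G x (nab2 (E i) (E i) \<xi> x) w
      = 2 * (D f x (E i) * G x (E i) w) - D f x w - G x (Rm x (E i) w (\<xi> x)) (E i)" for i
  proof -
    have "nab2 (E i) w \<xi> x = nab2 w (E i) \<xi> x + Rm x (E i) w (\<xi> x)"
      using nab2_commute[OF smooth_\<xi> x, of "E i" w] by (simp add: algebra_simps)
    moreover have "G x (E i) (nab2 w (E i) \<xi> x) = D f x w"
      using conformal_nab2[OF x, of w "E i" "E i"] sym[of "nab2 w (E i) \<xi> x" "E i"] E(1)
      by (simp add: orthonormal_def)
    ultimately show ?thesis
      using conformal_nab2[OF x, of "E i" "E i" w] sym[of "E i" "Rm x (E i) w (\<xi> x)"]
      by (simp add: h_simps)
  qed
  then have "G x (vector_laplacian G \<xi> x) w = (\<Sum>i\<in>UNIV.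
      2 * (D f x (E i) * G x (E i) w) - D f x w - G x (Rm x (E i) w (\<xi> x)) (E i))"
    by (simp add: E(2) linear_sum[OF linear_left])
  also have "\<dots> = 2 * D f x w - CARD('n) * D f x w - ricci G x w (\<xi> x)"
    using linear_form_orthonormal[OF E(1) smooth_on_linear_D[OF smooth_f x]]
    by (simp add: sum_subtractf sum_distrib_left[symmetric] ricci_orthonormal[OF x E(1)])
  finally show ?thesis
    using ricci_sym[OF x, of w "\<xi> x"] by (simp add: algebra_simps)
qed

text \<open>The covariant derivative of a gradient is a Hessian, hence symmetric; the conformal equation
  determines its symmetric part.\<close>

lemma gradient_imp_concircular:
  assumes grad: "\<And>y w. y \<in> S \<Longrightarrow> G y (\<xi> y) w = c * D f y w" and x: "x \<in> S"
  shows "nab u \<xi> x = f x *\<^sub>R u"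
proof -
  interpret euclidean_form "G x" using form[OF x] .
  have "G x (nab u \<xi> x) w = c * D (\<lambda>y. D f y w) x u - c * D f x (\<Gamma> x u w)" for u w
  proof -
    have "D (\<lambda>y. G y (\<xi> y) w) x u = D (\<lambda>y. c * D f y w) x u"
      by (rule fun_cong[OF D_cong[OF open_S x grad]])
    also have "\<dots> = c * D (\<lambda>y. D f y w) x u"
      by (rule bounded_linear.D_compose[OF bounded_linear_mult_right
            smooth_on_differentiable[OF smooth_on_D[OF smooth_f] x]])
    finally show ?thesis
      using D_metric[OF x smooth_on_differentiable[OF smooth_\<xi> x], of "\<lambda>_. w" u]
      by (simp add: nab_const grad[OF x])
  qed
  note A = this
  have "G x (nab u \<xi> x) w = G x (nab w \<xi> x) u" for w
    using second_derivative_symmetric[OF open_S x smooth_f, of w u] \<Gamma>_sym[OF x, of u w] by (simp add: A)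
  then have "G x (nab u \<xi> x) w = f x * G x u w" for w
    using conformal[OF x, of u w] sym[of u "nab w \<xi> x"] by simp
  then show ?thesis by (intro nondegenerate) (simp add: h_simps)
qed

end

locale concircular_field = conformal_field S G \<xi> f
  for S :: "(real ^ 'n::finite) set" and G \<xi> f +
  assumes concircular: "x \<in> S \<Longrightarrow> nab u \<xi> x = f x *\<^sub>R u"
begin

lemma nab2_concircular:
  assumes x: "x \<in> S"
  shows "nab2 u v \<xi> x = D f x u *\<^sub>R v"
proof -
  have "nab u (nab v \<xi>) x = nab u (\<lambda>y. f y *\<^sub>R v) x"
    by (rule nab_cong[OF x concircular])
  also have "\<dots> = D f x u *\<^sub>R v + f x *\<^sub>R \<Gamma> x u v"
    using bounded_linear.D_compose[OF bounded_linear_scaleR_left smooth_on_differentiable[OF smooth_f x], of v u]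
    by (simp add: cov_def \<Gamma>_simps[OF x])
  finally show ?thesis by (simp add: nab2_def concircular[OF x])
qed

lemma laplacian_concircular:
  assumes x: "x \<in> S"
  shows "G x (vector_laplacian G \<xi> x) w = D f x w"
proof -
  interpret euclidean_form "G x" using form[OF x] .
  obtain E where E: "orthonormal E"
    "vector_laplacian G \<xi> x = (\<Sum>i\<in>UNIV. nab2 (E i) (E i) \<xi> x)"
    by (rule vector_laplacian_nab2[OF smooth_\<xi> x])
  show ?thesis
    using linear_form_orthonormal[OF E(1) smooth_on_linear_D[OF smooth_f x], of w]
    by (simp add: E(2) nab2_concircular[OF x] linear_sum[OF linear_left] h_simps)
qed

text \<open>This compares two computations of the divergence of \<open>Q\<xi> = \<nu>\<xi>\<close>. Since \<open>\<nabla>\<xi> = f id\<close>, it is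
  \<open>n \<nu> f\<close> on the right; on the left it is \<open>f R\<close> plus half the derivative of \<open>R\<close> along \<open>\<xi>\<close>, by the
  contracted Bianchi identity.\<close>

lemma D_scalar_curvature_concircular:
  assumes ric: "\<And>y w. y \<in> S \<Longrightarrow> ricci G y (\<xi> y) w = \<nu> * G y (\<xi> y) w" and x: "x \<in> S"
  shows "D (scalar_curvature G) x (\<xi> x) = 2 * f x * (real CARD('n) * \<nu> - scalar_curvature G x)"
proof -
  obtain e where e: "orthonormal_frame G S e" using orthonormal_frame_exists by blast
  interpret euclidean_form "G x" using form[OF x] .
  have on: "orthonormal (\<lambda>i. e i x)" by (rule frame_orthonormal[OF e x x])
  have "nabla_Ric x u (\<xi> x) w = f x * (\<nu> * G x u w - ricci G x u w)" for u w
  proof -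
    have "D (\<lambda>y. ricci G y (\<xi> y) w) x u = D (\<lambda>y. \<nu> * G y (\<xi> y) w) x u"
      by (rule fun_cong[OF D_cong[OF open_S x ric]])
    also have "\<dots> = \<nu> * D (\<lambda>y. G y (\<xi> y) w) x u"
      by (rule bounded_linear.D_compose[OF bounded_linear_mult_right
            smooth_on_differentiable[OF smooth_G_fields[OF smooth_\<xi> smooth_on_const] x]])
    finally show ?thesis
      using D_ricci_fields[OF x smooth_\<xi> smooth_on_const, of w u]
        D_metric[OF x smooth_on_differentiable[OF smooth_\<xi> x], of "\<lambda>_. w" u]
      by (simp add: nab_const concircular[OF x] ric[OF x] h_simps linear_cmul[OF linear_ricci(2)[OF x]] algebra_simps)
  qed
  then show ?thesis
    using on unfolding orthonormal_def
    by (simp add: contracted_bianchi[OF x e] scalar_curvature_orthonormal[OF x on]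
        sum_distrib_left[symmetric] sum_subtractf)
qed

end

section \<open>Yamabe solitons\<close>

context riemannian_chart
begin

lemma lie_derivative_constant_fields:
  assumes x: "x \<in> S"
  shows "lie_derivative_metric G Z (\<lambda>_. u) (\<lambda>_. v) x
    = D (\<lambda>y. G y u v) x (Z x) + G x (D Z x u) v + G x u (D Z x v)"
  by (simp add: lie_derivative_metric_def lie_bracket_def G_simps[OF x])

lemma lie_derivative_nab:
  assumes x: "x \<in> S"
  shows "lie_derivative_metric G Z (\<lambda>_. u) (\<lambda>_. v) x = G x (nab u Z x) v + G x u (nab v Z x)"
  by (simp add: lie_derivative_constant_fields[OF x] levi_civita_koszul(3)[OF x] cov_def G_simps[OF x]
      \<Gamma>_sym[OF x, of u] \<Gamma>_sym[OF x, of v])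

text \<open>The local form of the theorem. Yano's formula and the hypotheses give \<open>(n - 2) \<nabla>f = (\<mu> - \<nu>) \<xi>\<close>
  for \<open>f = R - lam\<close>. Unless \<open>\<mu> = \<nu>\<close>, this makes \<open>\<xi>\<close> a gradient and therefore concircular, and then
  the derivative of \<open>R\<close> along \<open>\<xi>\<close> is both nonpositive and nonnegative.\<close>

lemma D_scalar_curvature_soliton:
  assumes smooth: "smooth_on S \<xi>"
    and soliton: "\<And>y u v. y \<in> S \<Longrightarrow> 1 / 2 * lie_derivative_metric G \<xi> (\<lambda>_. u) (\<lambda>_. v) y
      = (scalar_curvature G y - lam) * G y u v"
    and n: "CARD('n) > 2" and \<mu>: "\<mu> \<ge> 0"
    and lap: "\<And>y. y \<in> S \<Longrightarrow> vector_laplacian G \<xi> y = - \<mu> *\<^sub>R \<xi> y"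
    and ric: "\<And>y. y \<in> S \<Longrightarrow> ricci_operator G y (\<xi> y) = \<nu> *\<^sub>R \<xi> y"
    and low: "\<And>y. y \<in> S \<Longrightarrow> lam \<le> scalar_curvature G y"
    and up: "\<And>y. y \<in> S \<Longrightarrow> scalar_curvature G y \<le> real CARD('n) * (real CARD('n) - 1) * \<mu>"
    and x: "x \<in> S"
  shows "D (scalar_curvature G) x w = 0"
proof -
  let ?n = "real CARD('n)"
  define f where "f y = scalar_curvature G y - lam" for y
  have sf: "smooth_on S f" unfolding f_def
    by (intro smooth_on_diff smooth_scalar_curvature smooth_on_const open_S)
  have Df: "D f y v = D (scalar_curvature G) y v" if "y \<in> S" for y v
    using D_diff[OF smooth_on_differentiable[OF smooth_scalar_curvature that] differentiable_const, of lam v]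
    by (simp add: f_def[abs_def])
  interpret conformal_field S G \<xi> f
  proof
    show "G y (nab u \<xi> y) v + G y u (nab v \<xi> y) = 2 * f y * G y u v" if "y \<in> S" for y u v
      using soliton[OF that, of u v] by (simp add: lie_derivative_nab[OF that] f_def)
  qed (fact smooth sf)+
  have ric': "ricci G y (\<xi> y) v = \<nu> * G y (\<xi> y) v" if "y \<in> S" for y v
    using ricci_operator[OF that, of "\<xi> y" v] by (simp add: ric[OF that] G_simps[OF that])
  have grad: "(?n - 2) * D f y v = (\<mu> - \<nu>) * G y (\<xi> y) v" if "y \<in> S" for y v
    using laplacian_conformal[OF that, of v]
    by (simp add: lap[OF that] ric'[OF that] G_simps[OF that] algebra_simps)
  have "D f x w = 0"
  proof (cases "\<mu> = \<nu>")
    case True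
    then show ?thesis using grad[OF x, of w] n by simp
  next
    case False
    interpret concircular_field S G \<xi> f
    proof
      show "nab u \<xi> y = f y *\<^sub>R u" if "y \<in> S" for y u
      proof (rule gradient_imp_concircular[OF _ that])
        show "G z (\<xi> z) v = (?n - 2) / (\<mu> - \<nu>) * D f z v" if "z \<in> S" for z v
          using grad[OF that, of v] False by (simp add: field_simps)
      qed
    qed
    have Dxi: "D f x v = - \<mu> * G x (\<xi> x) v" for v
      using laplacian_concircular[OF x, of v] by (simp add: lap[OF x] G_simps[OF x])
    show ?thesis
    proof (cases "\<xi> x = 0")
      case True
      then show ?thesis by (simp add: Dxi G_simps[OF x])
    next
      case False
      then have pos: "G x (\<xi> x) (\<xi> x) > 0" by (rule euclidean_form.pos[OF form[OF x]])
      have "((?n - 2) * \<mu> + \<mu> - \<nu>) * G x (\<xi> x) (\<xi> x) = 0"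
        using grad[OF x, of "\<xi> x"] unfolding Dxi by (simp add: algebra_simps)
      \<comment> \<open>Two expressions for \<open>\<nabla>f\<close> as multiples of \<open>\<xi> \<noteq> 0\<close> tie \<open>\<nu>\<close> to \<open>\<mu>\<close>; this turns the upper bound
        on the scalar curvature into the sign that is needed.\<close>
      then have "(?n - 2) * \<mu> + \<mu> - \<nu> = 0" using pos by simp
      then have \<nu>: "\<nu> = (?n - 1) * \<mu>" by (simp add: algebra_simps)
      have "- \<mu> * G x (\<xi> x) (\<xi> x) = 2 * f x * (?n * \<nu> - scalar_curvature G x)"
        using D_scalar_curvature_concircular[OF ric' x] Dxi[of "\<xi> x"] by (simp add: Df[OF x])
      also have "\<dots> \<ge> 0"
        using low[OF x] up[OF x] by (intro mult_nonneg_nonneg) (simp_all add: f_def \<nu> mult.assoc)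
      finally have "\<mu> = 0"
        using pos \<mu> by (simp add: mult_le_0_iff)
      then show ?thesis by (simp add: Dxi)
    qed
  qed
  then show ?thesis by (simp add: Df[OF x])
qed

end

section \<open>Chart independence\<close>

text \<open>Naturality of the Lie derivative under a local isometry \<open>\<phi>\<close> that relates the fields. Differentiating
  the relation between the fields along \<open>u\<close> and the relation between the metrics along \<open>X\<close> produces
  second derivatives of \<open>\<phi>\<close>, which cancel because they are symmetric.\<close>

lemma lie_derivative_metric_pullback:
  assumes "riemannian_chart S G" "riemannian_chart T H"
    and \<phi>: "smooth_on V \<phi>" and V: "open V" "V \<subseteq> S" "\<phi> ` V \<subseteq> T"
    and X: "smooth_on S X" and Y: "smooth_on T Y"
    and push: "\<And>z. z \<in> V \<Longrightarrow> Y (\<phi> z) = D \<phi> z (X z)"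
    and iso: "\<And>z u v. z \<in> V \<Longrightarrow> H (\<phi> z) (D \<phi> z u) (D \<phi> z v) = G z u v"
    and x: "x \<in> V"
  shows "lie_derivative_metric H Y (\<lambda>_. D \<phi> x u) (\<lambda>_. D \<phi> x v) (\<phi> x)
    = lie_derivative_metric G X (\<lambda>_. u) (\<lambda>_. v) x"
proof -
  interpret G: riemannian_chart S G by fact
  interpret H: riemannian_chart T H by fact
  have T: "\<phi> z \<in> T" if "z \<in> V" for z using V(3) that by blast
  have dT: "(\<lambda>z. D \<phi> z u) differentiable at x" for u
    by (rule smooth_on_differentiable[OF smooth_on_D[OF \<phi>] x])
  have compose: "((\<lambda>z. k (\<phi> z)) has_derivative (\<lambda>w. D k (\<phi> x) (D \<phi> x w))) (at x)"
    if "k differentiable at (\<phi> x)" for k :: "_ \<Rightarrow> 'c::real_normed_vector"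
    by (rule has_derivative_compose[OF smooth_on_has_derivative[OF \<phi> x], where g = k])
      (use that in \<open>simp add: frechet_derivative_works\<close>)
  \<comment> \<open>The second derivative of \<open>\<phi>\<close> in the directions \<open>u\<close> and \<open>X x\<close>.\<close>
  define q where "q u = D (\<lambda>z. D \<phi> z (X x)) x u" for u
  have q: "D (\<lambda>z. D \<phi> z u) x (X x) = q u" for u
    unfolding q_def by (rule second_derivative_symmetric[OF V(1) x \<phi>])
  have DY: "D Y (\<phi> x) (D \<phi> x u) = q u + D \<phi> x (D X x u)" for u
  proof -
    have "D Y (\<phi> x) (D \<phi> x u) = D (\<lambda>z. Y (\<phi> z)) x u"
      using D_eqI[OF compose[OF smooth_on_differentiable[OF Y T[OF x]]]] by simp
    also have "\<dots> = D (\<lambda>z. D \<phi> z (X z)) x u"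
      by (rule fun_cong[OF D_cong[OF V(1) x push]])
    also have "\<dots> = q u + D \<phi> x (D X x u)"
      unfolding q_def
      by (rule D_linear_field[where L = "\<lambda>z. D \<phi> z", OF V(1) x smooth_on_linear_D[OF \<phi>] dT
            smooth_on_differentiable[OF X subsetD[OF V(2) x]]])
    finally show ?thesis .
  qed
  have dH: "(\<lambda>z. H (\<phi> z) a b) differentiable at x"
    and DH: "D (\<lambda>z. H (\<phi> z) a b) x w = D (\<lambda>y. H y a b) (\<phi> x) (D \<phi> x w)" for a b w
    using compose[OF smooth_on_differentiable[OF H.smooth_G[of a b] T[OF x]]]
    by (auto simp: differentiable_def D_eqI)
  have Hv: "((\<lambda>z. H (\<phi> z) a (D \<phi> z v)) has_derivative
      (\<lambda>w. D (\<lambda>z. H (\<phi> z) a (D \<phi> x v)) x w + H (\<phi> x) a (D (\<lambda>z. D \<phi> z v) x w))) (at x)" for a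
    by (rule has_derivative_linear_field[where L = "\<lambda>z. H (\<phi> z) a", OF V(1) x H.linear_G(2)[OF T] dH dT])
  then have dHv: "(\<lambda>z. H (\<phi> z) a (D \<phi> z v)) differentiable at x" for a
    by (auto simp: differentiable_def)
  have "D (\<lambda>y. G y u v) x (X x) = D (\<lambda>z. H (\<phi> z) (D \<phi> z u) (D \<phi> z v)) x (X x)"
    by (rule fun_cong[OF D_cong[OF V(1) x]]) (simp add: iso)
  also have "\<dots> = D (\<lambda>z. H (\<phi> z) (D \<phi> x u) (D \<phi> z v)) x (X x) + H (\<phi> x) (q u) (D \<phi> x v)"
    unfolding q[symmetric]
    by (rule D_linear_field[where L = "\<lambda>z a. H (\<phi> z) a (D \<phi> z v)", OF V(1) x H.linear_G(1)[OF T] dHv dT])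
  also have "D (\<lambda>z. H (\<phi> z) (D \<phi> x u) (D \<phi> z v)) x (X x)
      = D (\<lambda>y. H y (D \<phi> x u) (D \<phi> x v)) (\<phi> x) (Y (\<phi> x)) + H (\<phi> x) (D \<phi> x u) (q v)"
    by (simp add: D_eqI[OF Hv] DH push[OF x] q)
  finally show ?thesis
    using iso[OF x, of "D X x u" v] iso[OF x, of u "D X x v"]
    by (simp add: G.lie_derivative_constant_fields[OF subsetD[OF V(2) x]]
        H.lie_derivative_constant_fields[OF T[OF x]] DY H.G_simps[OF T[OF x]])
qed

lemma is_chart_inv_into:
  assumes "is_chart M c" "p \<in> chart_dom c"
  shows "inv_into (chart_dom c) (chart_map c) (chart_map c p) = p"
proof -
  have "chart_dom c \<subseteq> topspace M"
    using assms(1) by (simp add: is_chart_def openin_subset)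
  then have "inj_on (chart_map c) (chart_dom c)"
    using assms(1) homeomorphic_imp_injective_map[of "subtopology M (chart_dom c)"]
    by (auto simp: is_chart_def inf.absorb2)
  then show ?thesis using assms(2) by simp
qed

lemma open_chart_image:
  assumes c: "is_chart M c" and U: "openin M U" "U \<subseteq> chart_dom c"
  shows "open (chart_map c ` U)"
proof -
  have "openin (subtopology M (chart_dom c)) U"
    unfolding openin_subtopology using U by blast
  then have "openin (top_of_set (chart_img c)) (chart_map c ` U)"
    using c homeomorphic_imp_open_map unfolding is_chart_def open_map_def by blast
  then show ?thesis
    using c by (simp add: is_chart_def openin_open_eq)
qed

lemma openin_chart_vimage:
  assumes c: "is_chart M c" and W: "open W"
  shows "openin M {p \<in> chart_dom c. chart_map c p \<in> W}"
proof -
  have sub: "chart_dom c \<subseteq> topspace M" and op: "openin M (chart_dom c)"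
    using c by (simp_all add: is_chart_def openin_subset)
  have "continuous_map (subtopology M (chart_dom c)) (top_of_set (chart_img c)) (chart_map c)"
    using c homeomorphic_imp_continuous_map unfolding is_chart_def by blast
  moreover have "openin (top_of_set (chart_img c)) (chart_img c \<inter> W)"
    by (rule openin_open_Int[OF W])
  ultimately have "openin (subtopology M (chart_dom c))
      {p \<in> topspace (subtopology M (chart_dom c)). chart_map c p \<in> chart_img c \<inter> W}"
    by (rule openin_continuous_map_preimage)
  moreover have "{p \<in> topspace (subtopology M (chart_dom c)). chart_map c p \<in> chart_img c \<inter> W}
      = {p \<in> chart_dom c. chart_map c p \<in> W}"
    using sub by (auto simp: chart_img_def)
  ultimately show ?thesis using openin_trans_full[OF _ op] by simp
qed

lemma riemannian_chartI:
  assumes "riemannian_metric A g" "c \<in> A" "open (chart_img c)"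
  shows "riemannian_chart (chart_img c) (g c)"
  using assms by unfold_locales (auto simp: riemannian_metric_def)

text \<open>The soliton equation expresses the scalar curvature by the Lie derivative of the metric, whose
  behaviour under a change of charts involves only two derivatives of the transition map; so the
  transformation law of the curvature tensor can be bypassed.\<close>

lemma soliton_scalar_curvature_chart_independent:
  assumes sol: "yamabe_soliton M A g \<xi> lam" and cd: "c \<in> A" "d \<in> A"
    and p: "p \<in> chart_dom c" "p \<in> chart_dom d"
  shows "scalar_curvature (g c) (chart_map c p) = scalar_curvature (g d) (chart_map d p)"
proof -
  have mf: "smooth_manifold M A" and met: "riemannian_metric A g" and vf: "smooth_vector_field A \<xi>"
    using sol by (simp_all add: yamabe_soliton_def)
  have chart: "is_chart M c" "is_chart M d" using mf cd by (simp_all add: smooth_manifold_def)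
  have rc: "riemannian_chart (chart_img c) (g c)" "riemannian_chart (chart_img d) (g d)"
    using riemannian_chartI[OF met] cd chart by (simp_all add: is_chart_def)
  let ?\<phi> = "transition c d" and ?x = "chart_map c p" and ?V = "overlap c d"
  have trans: "?\<phi> (chart_map c q) = chart_map d q" if "q \<in> chart_dom c" for q
    by (simp add: transition_def is_chart_inv_into[OF chart(1) that])
  have V: "open ?V" "?V \<subseteq> chart_img c" "?\<phi> ` ?V \<subseteq> chart_img d" "?x \<in> ?V"
  proof -
    have "openin M (chart_dom c \<inter> chart_dom d)"
      using chart by (simp add: is_chart_def openin_Int)
    then show "open ?V" unfolding overlap_def by (rule open_chart_image[OF chart(1)]) simp
    show "?V \<subseteq> chart_img c" by (auto simp: overlap_def chart_img_def)
    show "?\<phi> ` ?V \<subseteq> chart_img d" using trans by (auto simp: overlap_def chart_img_def)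
    show "?x \<in> ?V" using p by (auto simp: overlap_def)
  qed
  have x: "?x \<in> chart_img c" "?\<phi> ?x \<in> chart_img d" using V by blast+
  have push: "\<xi> d (?\<phi> z) = D ?\<phi> z (\<xi> c z)" if "z \<in> ?V" for z
    using vf cd that unfolding smooth_vector_field_def by blast
  have iso: "g d (?\<phi> z) (D ?\<phi> z u) (D ?\<phi> z v) = g c z u v" if "z \<in> ?V" for z u v
    using met cd that unfolding riemannian_metric_def by blast
  have sm: "smooth_on ?V ?\<phi>" "smooth_on (chart_img c) (\<xi> c)" "smooth_on (chart_img d) (\<xi> d)"
    using mf vf cd by (simp_all add: smooth_manifold_def smooth_vector_field_def)
  have eq: "1 / 2 * lie_derivative_metric (g b) (\<xi> b) (\<lambda>_. u) (\<lambda>_. v) y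
      = (scalar_curvature (g b) y - lam) * g b y u v" if "b \<in> A" "y \<in> chart_img b" for b y u v
    using sol that smooth_on_const[of "chart_img b" u] smooth_on_const[of "chart_img b" v]
    unfolding yamabe_soliton_def by blast
  obtain u :: "real ^ 'b" where u: "u \<noteq> 0" using zero_neq_one by blast
  have "(scalar_curvature (g d) (?\<phi> ?x) - lam) * g c ?x u u
      = 1 / 2 * lie_derivative_metric (g d) (\<xi> d) (\<lambda>_. D ?\<phi> ?x u) (\<lambda>_. D ?\<phi> ?x u) (?\<phi> ?x)"
    unfolding eq[OF cd(2) x(2)] iso[OF V(4)] ..
  also have "\<dots> = 1 / 2 * lie_derivative_metric (g c) (\<xi> c) (\<lambda>_. u) (\<lambda>_. u) ?x"
    by (rule arg_cong[OF lie_derivative_metric_pullback[OF rc sm(1) V(1-3) sm(2,3) push iso V(4)]])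
  also have "\<dots> = (scalar_curvature (g c) ?x - lam) * g c ?x u u"
    by (rule eq[OF cd(1) x(1)])
  finally have "(scalar_curvature (g d) (?\<phi> ?x) - lam) * g c ?x u u
      = (scalar_curvature (g c) ?x - lam) * g c ?x u u" .
  moreover have "g c ?x u u > 0"
    using euclidean_form.pos[OF riemannian_chart.form[OF rc(1) x(1)] u] .
  ultimately show ?thesis using trans[OF p(1)] by simp
qed

section \<open>Rigidity of Yamabe solitons\<close>

lemma locally_constant_imp_constant:
  assumes conn: "connected_space M"
    and loc: "\<And>p. p \<in> topspace M \<Longrightarrow> \<exists>U. openin M U \<and> p \<in> U \<and> (\<forall>q\<in>U. r q = r p)"
  shows "\<exists>k. \<forall>p\<in>topspace M. r p = k"
proof (cases "topspace M = {}")
  case False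
  then obtain p0 where p0: "p0 \<in> topspace M" by blast
  have op: "openin M {p \<in> topspace M. P (r p)}" (is "openin M ?Q") for P
  proof -
    have "\<exists>U. openin M U \<and> p \<in> U \<and> U \<subseteq> ?Q" if p: "p \<in> ?Q" for p
    proof -
      obtain U where U: "openin M U" "p \<in> U" "\<And>q. q \<in> U \<Longrightarrow> r q = r p" using loc[of p] p by blast
      have "U \<subseteq> ?Q"
      proof
        fix q assume "q \<in> U"
        then show "q \<in> ?Q" using openin_subset[OF U(1)] U(3)[of q] p by auto
      qed
      then show ?thesis using U(1,2) by blast
    qed
    then show ?thesis by (subst openin_subopen) blast
  qed
  let ?T = "{p \<in> topspace M. r p = r p0}"
  have "topspace M - ?T = {p \<in> topspace M. r p \<noteq> r p0}" by auto
  then have "closedin M ?T" using op[of "\<lambda>a. a \<noteq> r p0"] by (simp add: closedin_def)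
  moreover have "openin M ?T" by (rule op)
  ultimately have "?T = {} \<or> ?T = topspace M"
    using conn[unfolded connected_space_clopen_in, rule_format, of ?T] by simp
  moreover have "p0 \<in> ?T" using p0 by simp
  ultimately have "?T = topspace M" by auto
  then have "\<forall>p\<in>topspace M. r p = r p0" by blast
  then show ?thesis by blast
qed simp

theorem proposition3p1:
  fixes M :: "'a topology" and A :: "('a, 'n::finite) chart set"
    and g :: "('a, 'n) chart \<Rightarrow> 'n metric" and \<xi> :: "('a, 'n) chart \<Rightarrow> 'n vfield"
    and lam \<mu> \<nu> :: real
  assumes "yamabe_soliton M A g \<xi> lam"
    and "CARD('n) > 2"
    and "\<mu> \<ge> 0"
    and "\<forall>c\<in>A. \<forall>x\<in>chart_img c. vector_laplacian (g c) (\<xi> c) x = - \<mu> *\<^sub>R \<xi> c x"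
    and "\<forall>c\<in>A. \<forall>x\<in>chart_img c. ricci_operator (g c) x (\<xi> c x) = \<nu> *\<^sub>R \<xi> c x"
    and "\<forall>c\<in>A. \<forall>x\<in>chart_img c. lam \<le> scalar_curvature (g c) x \<and>
           scalar_curvature (g c) x \<le> real CARD('n) * (real CARD('n) - 1) * \<mu>"
  shows "yamabe_metric A g"
proof -
  note sol = assms(1)
  have conn: "connected_space M" and mf: "smooth_manifold M A" and met: "riemannian_metric A g"
    and vf: "smooth_vector_field A \<xi>"
    using sol by (simp_all add: yamabe_soliton_def)
  have chart: "is_chart M c" if "c \<in> A" for c using mf that by (simp add: smooth_manifold_def)
  have cover: "(\<Union>c\<in>A. chart_dom c) = topspace M" using mf by (simp add: smooth_manifold_def)
  have rc: "riemannian_chart (chart_img c) (g c)" if "c \<in> A" for c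
    using riemannian_chartI[OF met that] chart[OF that] by (simp add: is_chart_def)
  have D0: "D (scalar_curvature (g c)) x w = 0" if c: "c \<in> A" and x: "x \<in> chart_img c" for c x w
  proof (rule riemannian_chart.D_scalar_curvature_soliton[where \<xi> = "\<xi> c" and lam = lam and \<mu> = \<mu> and \<nu> = \<nu>,
        OF rc[OF c] _ _ assms(2,3) _ _ _ _ x])
    show "smooth_on (chart_img c) (\<xi> c)"
      using vf c by (simp add: smooth_vector_field_def)
    show "1 / 2 * lie_derivative_metric (g c) (\<xi> c) (\<lambda>_. u) (\<lambda>_. v) y
        = (scalar_curvature (g c) y - lam) * g c y u v" if "y \<in> chart_img c" for y u v
      using sol c that smooth_on_const[of "chart_img c" u] smooth_on_const[of "chart_img c" v]
      unfolding yamabe_soliton_def by blast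
    show "vector_laplacian (g c) (\<xi> c) y = - \<mu> *\<^sub>R \<xi> c y" if "y \<in> chart_img c" for y
      using assms(4) c that by blast
    show "ricci_operator (g c) y (\<xi> c y) = \<nu> *\<^sub>R \<xi> c y" if "y \<in> chart_img c" for y
      using assms(5) c that by blast
    show "lam \<le> scalar_curvature (g c) y" if "y \<in> chart_img c" for y
      using assms(6) c that by blast
    show "scalar_curvature (g c) y \<le> real CARD('n) * (real CARD('n) - 1) * \<mu>"
      if "y \<in> chart_img c" for y
      using assms(6) c that by blast
  qed
  \<comment> \<open>The scalar curvature as a function on the manifold.\<close>
  define r where "r p = (let c = SOME c. c \<in> A \<and> p \<in> chart_dom c in scalar_curvature (g c) (chart_map c p))" for p
  have r: "r p = scalar_curvature (g c) (chart_map c p)" if "c \<in> A" "p \<in> chart_dom c" for c p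
  proof -
    have "(SOME c. c \<in> A \<and> p \<in> chart_dom c) \<in> A \<and> p \<in> chart_dom (SOME c. c \<in> A \<and> p \<in> chart_dom c)"
      by (rule someI[of _ c]) (use that in blast)
    then show ?thesis
      using soliton_scalar_curvature_chart_independent[OF sol _ that(1) _ that(2)] by (simp add: r_def Let_def)
  qed
  have "\<exists>U. openin M U \<and> p \<in> U \<and> (\<forall>q\<in>U. r q = r p)" if pM: "p \<in> topspace M" for p
  proof -
    obtain c where c: "c \<in> A" "p \<in> chart_dom c"
      using UN_E[OF pM[folded cover]] .
    have p: "chart_map c p \<in> chart_img c" unfolding chart_img_def by (rule imageI[OF c(2)])
    have "open (chart_img c)" using chart[OF c(1)] by (simp add: is_chart_def)
    then obtain e where e: "e > 0" "ball (chart_map c p) e \<subseteq> chart_img c"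
      using p by (rule openE)
    let ?B = "ball (chart_map c p) e"
    have der: "(scalar_curvature (g c) has_derivative (\<lambda>_. 0)) (at z within ?B)" if "z \<in> ?B" for z
    proof -
      have z: "z \<in> chart_img c" by (rule subsetD[OF e(2) that])
      have "(scalar_curvature (g c) has_derivative D (scalar_curvature (g c)) z) (at z)"
        by (rule smooth_on_has_derivative[OF riemannian_chart.smooth_scalar_curvature[OF rc[OF c(1)]] z])
      moreover have "D (scalar_curvature (g c)) z = (\<lambda>_. 0)" by (rule ext) (rule D0[OF c(1) z])
      ultimately show ?thesis by (simp only: has_derivative_at_withinI)
    qed
    have const: "scalar_curvature (g c) y = scalar_curvature (g c) (chart_map c p)" if "y \<in> ?B" for y
      by (rule has_derivative_zero_unique[OF convex_ball der that]) (simp_all add: e(1))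
    let ?U = "{q \<in> chart_dom c. chart_map c q \<in> ?B}"
    have "openin M ?U" by (rule openin_chart_vimage[OF chart[OF c(1)] open_ball])
    moreover have "p \<in> ?U" using c(2) e(1) by simp
    moreover have "r q = r p" if "q \<in> ?U" for q
    proof -
      have "q \<in> chart_dom c" "chart_map c q \<in> ?B" using that by auto
      then show ?thesis unfolding r[OF c] r[OF c(1) \<open>q \<in> chart_dom c\<close>] by (intro const)
    qed
    ultimately show ?thesis by blast
  qed
  from locally_constant_imp_constant[OF conn this] obtain k where k: "\<And>p. p \<in> topspace M \<Longrightarrow> r p = k"
    by blast
  have "scalar_curvature (g c) x = k" if "c \<in> A" "x \<in> chart_img c" for c x
  proof -
    obtain p where p: "p \<in> chart_dom c" "x = chart_map c p" using \<open>x \<in> chart_img c\<close> by (auto simp: chart_img_def)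
    then show ?thesis using r[OF \<open>c \<in> A\<close> p(1)] k[of p] cover \<open>c \<in> A\<close> by (metis UN_I)
  qed
  then show ?thesis by (auto simp: yamabe_metric_def)
qed

end
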